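(* Let $(\mathscr{M};\mathcal{H})$, $(\mathscr{N};\mathcal{K})$ be represented von Neumann algebras and $\Phi:\mathscr{M}\to\mathscr{N}$ be a unital normal $*$-homomorphism. Let $\Phi_{\mathrm{aff}}:\mathscr{M}_{\mathrm{aff}}\to\mathscr{N}_{\mathrm{aff}}$ be the extension of $\Phi$ given by $\Phi_{\mathrm{aff}}(A/B)=\Phi(A)/\Phi(B)$. Then $\Phi_{\mathrm{aff}}$ is the unique mapping from $\mathscr{M}_{\mathrm{aff}}$ to $\mathscr{N}_{\mathrm{aff}}$ which extends $\Phi$, and respects product and Kaufman-inverse.
   Context: A represented von Neumann algebra $(\mathscr{M};\mathcal{H})$ is a von Neumann algebra $\mathscr{M}$ acting on a complex Hilbert space $\mathcal{H}$. An unbounded operator on $\mathcal{H}$ is a linear map $T:\mathrm{dom}(T)\to\mathcal{H}$ with $\mathrm{dom}(T)$ a (not necessarily dense) linear subspace of $\mathcal{H}$, and $T$ not necessarily bounded; equality of operators includes equality of domains. For $A,B\in\mathcal{B}(\mathcal{H})$ with $\mathrm{null}(B)\subseteq\mathrm{null}(A)$, the quotient $A/B$ is the unbounded operator with domain $\mathrm{ran}(B)$ given by $Bx\mapsto Ax$ ($x\in\mathcal{H}$). $\mathscr{M}_{\mathrm{aff}} := \{A/B : A,B\in\mathscr{M},\ \mathrm{null}(B)\subseteq\mathrm{null}(A)\}$, which contains $\mathscr{M}$ via $A=A/I$. The map $\Phi_{\mathrm{aff}}$ is defined by $\Phi_{\mathrm{aff}}(A/B):=\Phi(A)/\Phi(B)$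 for all $A,B\in\mathscr{M}$ with $\mathrm{null}(B)\subseteq\mathrm{null}(A)$; this makes sense and does not depend on the choice of quotient representation. Product: $\mathrm{dom}(ST)=\{x\in\mathrm{dom}(T): Tx\in\mathrm{dom}(S)\}$, $(ST)x=S(Tx)$. The Kaufman inverse $T^{\dagger}$ has $\mathrm{dom}(T^{\dagger})=\mathrm{ran}(T)$ and is given by $Tx\mapsto (I-\mathbf{N}(T))x$ ($x\in\mathrm{dom}(T)$), where $\mathbf{N}(T)$ is the orthogonal projection onto $\overline{\mathrm{null}(T)}$. The set $\mathscr{M}_{\mathrm{aff}}$ is closed under product and Kaufman inverse. A map $\Psi:\mathscr{M}_{\mathrm{aff}}\to\mathscr{N}_{\mathrm{aff}}$ respects product and Kaufman-inverse if $\Psi(ST)=\Psi(S)\Psi(T)$ and $\Psi(T^{\dagger})=\Psi(T)^{\dagger}$ for all $S,T\in\mathscr{M}_{\mathrm{aff}}$. *)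

theory Defs
  imports "HOL-Analysis.Analysis"
begin

text \<open>The inner product is conjugate-linear in its first argument. The last axiom makes it
  positive definite and makes the norm of the type the norm it induces; completeness
  comes from \<^class>\<open>banach\<close>.\<close>

class chilbert_space = banach +
  fixes scaleC :: "complex \<Rightarrow> 'a \<Rightarrow> 'a" (infixr "*\<^sub>C" 75)
    and cinner :: "'a \<Rightarrow> 'a \<Rightarrow> complex"
  assumes scaleC_add_right: "c *\<^sub>C (x + y) = c *\<^sub>C x + c *\<^sub>C y"
    and scaleC_add_left: "(c + d) *\<^sub>C x = c *\<^sub>C x + d *\<^sub>C x"
    and scaleC_scaleC: "c *\<^sub>C d *\<^sub>C x = (c * d) *\<^sub>C x"
    and scaleC_of_real: "complex_of_real r *\<^sub>C x = r *\<^sub>R x"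
    and cinner_commute: "cinner x y = cnj (cinner y x)"
    and cinner_add_left: "cinner (x + y) z = cinner x z + cinner y z"
    and cinner_scaleC_left: "cinner (c *\<^sub>C x) y = cnj c * cinner x y"
    and cinner_self: "cinner x x = complex_of_real ((norm x)\<^sup>2)"

instantiation complex :: chilbert_space
begin

definition scaleC_complex :: "complex \<Rightarrow> complex \<Rightarrow> complex" where
  "scaleC_complex c x = c * x"

definition cinner_complex :: "complex \<Rightarrow> complex \<Rightarrow> complex" where
  "cinner_complex x y = cnj x * y"

instance
proof
  show "cinner x x = complex_of_real ((norm x)\<^sup>2)" for x :: complex
    by (metis cinner_complex_def complex_norm_square mult.commute of_real_power)
qed (auto simp: scaleC_complex_def cinner_complex_def algebra_simps scaleR_conv_of_real)

end

definition bounded_ops :: "('h::chilbert_space \<Rightarrow> 'h) set" where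
  "bounded_ops = {T. bounded_linear T \<and> (\<forall>c x. T (c *\<^sub>C x) = c *\<^sub>C T x)}"

definition cadjoint :: "('h::chilbert_space \<Rightarrow> 'h) \<Rightarrow> 'h \<Rightarrow> 'h" where
  "cadjoint T = (THE S. \<forall>x y. cinner (T x) y = cinner x (S y))"

definition commutant :: "('h::chilbert_space \<Rightarrow> 'h) set \<Rightarrow> ('h \<Rightarrow> 'h) set" where
  "commutant X = {T \<in> bounded_ops. \<forall>A\<in>X. T \<circ> A = A \<circ> T}"

text \<open>Linearity, closure under products and containment of the identity follow from
  being a commutant.\<close>

definition von_neumann_algebra :: "('h::chilbert_space \<Rightarrow> 'h) set \<Rightarrow> bool" where
  "von_neumann_algebra M \<longleftrightarrow>
     M \<subseteq> bounded_ops \<and> (\<forall>A\<in>M. cadjoint A \<in> M) \<and> commutant (commutant M) = M"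

definition unital_star_hom ::
  "('h::chilbert_space \<Rightarrow> 'h) set \<Rightarrow> ('k::chilbert_space \<Rightarrow> 'k) set
    \<Rightarrow> (('h \<Rightarrow> 'h) \<Rightarrow> ('k \<Rightarrow> 'k)) \<Rightarrow> bool" where
  "unital_star_hom M N \<Phi> \<longleftrightarrow>
     \<Phi> \<in> M \<rightarrow> N \<and>
     (\<forall>A\<in>M. \<forall>B\<in>M. \<Phi> (\<lambda>x. A x + B x) = (\<lambda>x. \<Phi> A x + \<Phi> B x)) \<and>
     (\<forall>c. \<forall>A\<in>M. \<Phi> (\<lambda>x. c *\<^sub>C A x) = (\<lambda>x. c *\<^sub>C \<Phi> A x)) \<and>
     (\<forall>A\<in>M. \<forall>B\<in>M. \<Phi> (A \<circ> B) = \<Phi> A \<circ> \<Phi> B) \<and>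
     (\<forall>A\<in>M. \<Phi> (cadjoint A) = cadjoint (\<Phi> A)) \<and>
     \<Phi> id = id"

definition selfadjoint_part :: "('h::chilbert_space \<Rightarrow> 'h) set \<Rightarrow> ('h \<Rightarrow> 'h) set" where
  "selfadjoint_part M = {A \<in> M. cadjoint A = A}"

text \<open>The order of self-adjoint operators; it is only ever used for these, whose
  quadratic forms are real.\<close>

definition op_le :: "('h::chilbert_space \<Rightarrow> 'h) \<Rightarrow> ('h \<Rightarrow> 'h) \<Rightarrow> bool" where
  "op_le A B \<longleftrightarrow> (\<forall>x. Re (cinner x (A x)) \<le> Re (cinner x (B x)))"

definition op_is_lub ::
  "('h::chilbert_space \<Rightarrow> 'h) set \<Rightarrow> ('h \<Rightarrow> 'h) set \<Rightarrow> ('h \<Rightarrow> 'h) \<Rightarrow> bool" where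
  "op_is_lub M D S \<longleftrightarrow>
     S \<in> selfadjoint_part M \<and> (\<forall>A\<in>D. op_le A S) \<and>
     (\<forall>R\<in>selfadjoint_part M. (\<forall>A\<in>D. op_le A R) \<longrightarrow> op_le S R)"

text \<open>Normality is preservation of least upper bounds of increasing nets of self-adjoint
  elements. Only the range of the net matters, which is an arbitrary nonempty upward
  directed set \<open>D\<close>.\<close>

definition normal_map ::
  "('h::chilbert_space \<Rightarrow> 'h) set \<Rightarrow> ('k::chilbert_space \<Rightarrow> 'k) set
    \<Rightarrow> (('h \<Rightarrow> 'h) \<Rightarrow> ('k \<Rightarrow> 'k)) \<Rightarrow> bool" where
  "normal_map M N \<Phi> \<longleftrightarrow>
     (\<forall>D S. D \<subseteq> selfadjoint_part M \<longrightarrow> D \<noteq> {} \<longrightarrow>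
        (\<forall>A\<in>D. \<forall>B\<in>D. \<exists>C\<in>D. op_le A C \<and> op_le B C) \<longrightarrow>
        op_is_lub M D S \<longrightarrow> op_is_lub N (\<Phi> ` D) (\<Phi> S))"

text \<open>An unbounded operator is a partial map \<open>'h \<rightharpoonup> 'h\<close>, so that equality includes
  equality of the domains \<^term>\<open>dom\<close>. The product of \<open>S\<close> and \<open>T\<close> is then \<open>S \<circ>\<^sub>m T\<close>, and a
  bounded operator \<open>A\<close> is the quotient \<open>A/I\<close>. The value \<open>op_quot A B\<close> is meaningful
  only if \<open>op_null B \<subseteq> op_null A\<close>.\<close>

definition op_null :: "('h::chilbert_space \<Rightarrow> 'h) \<Rightarrow> 'h set" where
  "op_null A = {x. A x = 0}"

definition op_quot :: "('h::chilbert_space \<Rightarrow> 'h) \<Rightarrow> ('h \<Rightarrow> 'h) \<Rightarrow> 'h \<rightharpoonup> 'h" where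
  "op_quot A B = (\<lambda>y. if y \<in> range B then Some (THE z. \<exists>x. B x = y \<and> z = A x) else None)"

definition aff :: "('h::chilbert_space \<Rightarrow> 'h) set \<Rightarrow> ('h \<rightharpoonup> 'h) set" where
  "aff M = {op_quot A B | A B. A \<in> M \<and> B \<in> M \<and> op_null B \<subseteq> op_null A}"

definition orth_proj :: "'h::chilbert_space set \<Rightarrow> 'h \<Rightarrow> 'h" where
  "orth_proj U x = (THE p. p \<in> U \<and> (\<forall>u\<in>U. cinner u (x - p) = 0))"

definition null_proj :: "('h::chilbert_space \<rightharpoonup> 'h) \<Rightarrow> 'h \<Rightarrow> 'h" where
  "null_proj T = orth_proj (closure {x. T x = Some 0})"

definition kaufman_inv :: "('h::chilbert_space \<rightharpoonup> 'h) \<Rightarrow> 'h \<rightharpoonup> 'h" where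
  "kaufman_inv T =
     (\<lambda>y. if y \<in> ran T then Some (THE z. \<exists>x. T x = Some y \<and> z = x - null_proj T x) else None)"

definition aff_ext ::
  "('h::chilbert_space \<Rightarrow> 'h) set \<Rightarrow> (('h \<Rightarrow> 'h) \<Rightarrow> ('k::chilbert_space \<Rightarrow> 'k))
    \<Rightarrow> ('h \<rightharpoonup> 'h) \<Rightarrow> ('k \<rightharpoonup> 'k)" where
  "aff_ext M \<Phi> T =
     (THE R. \<exists>A\<in>M. \<exists>B\<in>M. op_null B \<subseteq> op_null A \<and> T = op_quot A B \<and> R = op_quot (\<Phi> A) (\<Phi> B))"

definition extends_map ::
  "('h::chilbert_space \<Rightarrow> 'h) set \<Rightarrow> (('h \<Rightarrow> 'h) \<Rightarrow> ('k::chilbert_space \<Rightarrow> 'k))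
    \<Rightarrow> (('h \<rightharpoonup> 'h) \<Rightarrow> ('k \<rightharpoonup> 'k)) \<Rightarrow> bool" where
  "extends_map M \<Phi> \<Psi> \<longleftrightarrow> (\<forall>A\<in>M. \<Psi> (op_quot A id) = op_quot (\<Phi> A) id)"

definition respects_product ::
  "('h::chilbert_space \<Rightarrow> 'h) set \<Rightarrow> (('h \<rightharpoonup> 'h) \<Rightarrow> ('k::chilbert_space \<rightharpoonup> 'k)) \<Rightarrow> bool" where
  "respects_product M \<Psi> \<longleftrightarrow> (\<forall>S\<in>aff M. \<forall>T\<in>aff M. \<Psi> (S \<circ>\<^sub>m T) = \<Psi> S \<circ>\<^sub>m \<Psi> T)"

definition respects_kaufman_inv ::
  "('h::chilbert_space \<Rightarrow> 'h) set \<Rightarrow> (('h \<rightharpoonup> 'h) \<Rightarrow> ('k::chilbert_space \<rightharpoonup> 'k)) \<Rightarrow> bool" where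
  "respects_kaufman_inv M \<Psi> \<longleftrightarrow> (\<forall>T\<in>aff M. \<Psi> (kaufman_inv T) = kaufman_inv (\<Psi> T))"

end

(* The heart of the matter is Douglas factorization inside a von Neumann algebra: if ran A is
   contained in ran B, then A = B C with C in the algebra (the bound |A^* y| <= K |B^* y| comes from the
   Baire category theorem, and C lies in the algebra because it is determined uniquely and hence commutes
   with the commutant). Such factorizations are preserved by a homomorphism, so Phi_aff is well defined
   as soon as Phi preserves inclusions of null spaces. This is where normality enters: the powers of
   1 - r^2 B^* B decrease to the projection N(B) onto null(B), so that Phi(N(B)) = N(Phi(B)).

   Products and Kaufman inverses are then quotients given by formulas in the algebra:
   (A/B)(C/D) = AE/(DF), where x |-> (F x, E x) parametrises the pairs with C(F x) = B(E x), and
   (A/B)^dagger = ((1 - P) B)/A, where P projects onto the closure of B(null A). Uniqueness follows from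
   A/B = A B^dagger. *)
theory Submission imports Defs begin

section \<open>Geometry of the Hilbert space\<close>

text \<open>The obstacle is the product. Its domain is governed by the pairs with C x = B y, the
  null space of the row (C, -B), whose projection is a 2 x 2 matrix over the algebra. Instead of
  passing to the matrix algebra and proving an amplified homomorphism normal there, the row is
  replaced by the partial isometry of its polar decomposition. Its null projection is then a
  polynomial in the entries and their adjoints, which every *-homomorphism respects. A second polar
  decomposition, of the first row of that matrix, rewrites the range of a row as the range of a
  single operator F. Absolute values of rows need square roots; these come from a power series,
  which visibly commutes with the commutant and avoids spectral theory.

  What has to cross \<Phi> is thereby of two kinds: identities between elements of the algebra, and
  inclusions of null spaces. Range inclusions become identities by Douglas factorization, and the
  closure of a range is handled as the orthogonal complement of the null space of the
  adjoint.\<close>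

lemma cinner_add_right: "cinner x (y + z) = cinner x y + cinner x (z::'h::chilbert_space)"
  by (metis cinner_add_left cinner_commute complex_cnj_add)

lemma cinner_scaleC_right: "cinner x (c *\<^sub>C y) = c * cinner x (y::'h::chilbert_space)"
  by (metis cinner_scaleC_left cinner_commute complex_cnj_cnj complex_cnj_mult)

lemma cinner_scaleR_left: "cinner (r *\<^sub>R x) y = r *\<^sub>R cinner x (y::'h::chilbert_space)"
  by (metis cinner_scaleC_left complex_cnj_complex_of_real scaleC_of_real scaleR_conv_of_real)

lemma cinner_scaleR_right: "cinner x (r *\<^sub>R y) = r *\<^sub>R cinner x (y::'h::chilbert_space)"
  by (metis cinner_scaleC_right scaleC_of_real scaleR_conv_of_real)

lemma power2_norm_add_scaled:
  fixes x y :: "'h::chilbert_space"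
  shows "(norm (x + t *\<^sub>R y))\<^sup>2 = (norm x)\<^sup>2 + 2 * t * Re (cinner x y) + t\<^sup>2 * (norm y)\<^sup>2"
proof -
  have "(norm (x + t *\<^sub>R y))\<^sup>2 = Re (cinner (x + t *\<^sub>R y) (x + t *\<^sub>R y))"
    by (simp add: cinner_self)
  also have "\<dots> = Re (cinner x x) + t * (Re (cinner x y) + Re (cinner y x)) + t\<^sup>2 * Re (cinner y y)"
    unfolding cinner_add_left cinner_add_right cinner_scaleR_left cinner_scaleR_right
    by (simp add: algebra_simps power2_eq_square)
  also have "Re (cinner y x) = Re (cinner x y)"
    by (metis cinner_commute cnj.simps(1))
  finally show ?thesis by (simp add: cinner_self)
qed

text \<open>First-order condition for a minimum. Testing at t = -a/c with c > 0 and c > b gives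
  (a^2/c)(b/c - 2), which is negative unless a = 0.\<close>

lemma linear_coeff_zero_if_nonneg:
  fixes a b :: real
  assumes "\<And>t. 0 \<le> 2 * t * a + t\<^sup>2 * b"
  shows "a = 0"
proof (rule ccontr)
  assume a: "a \<noteq> 0"
  define c where "c = \<bar>b\<bar> + 1"
  have c: "c > 0" "b < c" by (auto simp: c_def)
  have "0 \<le> 2 * (- a / c) * a + (- a / c)\<^sup>2 * b" by (rule assms)
  also have "\<dots> = (a\<^sup>2 / c) * (b / c - 2)"
    using c by (simp add: field_simps power2_eq_square)
  finally have "0 \<le> (a\<^sup>2 / c) * (b / c - 2)" .
  moreover have "a\<^sup>2 / c > 0" using a c by simp
  moreover have "b / c - 2 < 0" using c by (simp add: field_simps)
  ultimately show False by (meson mult_pos_neg not_le)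
qed

lemma Re_cinner_le: "Re (cinner x y) \<le> norm x * norm (y::'h::chilbert_space)"
proof (cases "norm x = 0 \<or> norm y = 0")
  case True
  have "cinner 0 v = 0" "cinner v 0 = 0" for v :: 'h
    using cinner_add_left[of 0 0 v] cinner_add_right[of v 0 0] by auto
  then show ?thesis using True by auto
next
  case False
  then have p: "norm x > 0" "norm y > 0" by auto
  \<comment> \<open>The factor gives y the length of x, so that the two quadratic terms of the
    expansion coincide.\<close>
  have "0 \<le> (norm (x + (- (norm x / norm y)) *\<^sub>R y))\<^sup>2" by simp
  also have "\<dots> = 2 * (norm x)\<^sup>2 - 2 * (norm x / norm y) * Re (cinner x y)"
    unfolding power2_norm_add_scaled using p by (simp add: power_divide)
  finally have "(norm x / norm y) * Re (cinner x y) \<le> (norm x / norm y) * (norm x * norm y)"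
    using p by (simp add: power2_eq_square)
  moreover have "norm x / norm y > 0" using p by simp
  ultimately show ?thesis by (simp only: mult_le_cancel_left_pos)
qed

lemma cinner_Cauchy_Schwarz: "cmod (cinner x y) \<le> norm x * norm (y::'h::chilbert_space)"
proof (cases "cinner x y = 0")
  case False
  \<comment> \<open>A unimodular phase that makes the inner product with x real and nonnegative,
    reducing to the bound on the real part.\<close>
  define c where "c = cnj (cinner x y) / cmod (cinner x y)"
  have c1: "cmod c = 1" using False by (simp add: c_def norm_divide)
  have "complex_of_real ((norm (c *\<^sub>C y))\<^sup>2) = cnj c * c * cinner y y"
    by (metis cinner_self cinner_scaleC_left cinner_scaleC_right mult.assoc)
  also have "cnj c * c = 1"
    using c1 complex_norm_square[of c] by (simp add: mult.commute)
  finally have "(norm (c *\<^sub>C y))\<^sup>2 = (norm y)\<^sup>2"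
    by (metis cinner_self mult_1 of_real_eq_iff)
  then have n: "norm (c *\<^sub>C y) = norm y" by (simp add: power2_eq_iff_nonneg)
  have "cinner x (c *\<^sub>C y) = cmod (cinner x y)"
    using False complex_norm_square[of "cinner x y"]
    by (simp add: cinner_scaleC_right c_def field_simps power2_eq_square)
  then show ?thesis using Re_cinner_le[of x "c *\<^sub>C y"] n by simp
qed simp

lemma bounded_bilinear_cinner:
  "bounded_bilinear (cinner :: 'h::chilbert_space \<Rightarrow> 'h \<Rightarrow> complex)"
proof
  show "\<exists>K. \<forall>(a::'h) b. cmod (cinner a b) \<le> norm a * norm b * K"
    by (rule exI[of _ 1]) (simp add: cinner_Cauchy_Schwarz)
qed (auto simp: cinner_add_left cinner_add_right cinner_scaleR_left cinner_scaleR_right)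

interpretation cinner: bounded_bilinear "cinner :: 'h::chilbert_space \<Rightarrow> 'h \<Rightarrow> complex"
  by (rule bounded_bilinear_cinner)

lemma cinner_self_eq_0 [simp]: "cinner x x = 0 \<longleftrightarrow> x = (0::'h::chilbert_space)"
  by (simp add: cinner_self)

lemma cinner_left_ext:
  assumes "\<And>z. cinner z x = cinner z (y::'h::chilbert_space)"
  shows "x = y"
  using assms[of "x - y"] by (metis cinner.diff_right cinner_self_eq_0 right_minus_eq)

lemma norm_scaleC: "norm (c *\<^sub>C x) = cmod c * norm (x::'h::chilbert_space)"
proof -
  have "complex_of_real ((norm (c *\<^sub>C x))\<^sup>2) = of_real ((cmod c * norm x)\<^sup>2)"
    unfolding cinner_self[symmetric] cinner_scaleC_left cinner_scaleC_right
    by (simp add: cinner_self power_mult_distrib complex_norm_square[symmetric] mult.assoc[symmetric]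
        mult.commute[of "cnj c"])
  then have "(norm (c *\<^sub>C x))\<^sup>2 = (cmod c * norm x)\<^sup>2" by (simp only: of_real_eq_iff)
  then show ?thesis by (simp add: power2_eq_iff_nonneg)
qed

lemma power2_norm_eq_cinner: "(norm x)\<^sup>2 = Re (cinner x (x::'h::chilbert_space))"
  by (simp add: cinner_self)

lemma power2_norm_diff:
  fixes x y :: "'h::chilbert_space"
  shows "(norm (x - y))\<^sup>2 = (norm x)\<^sup>2 - 2 * Re (cinner x y) + (norm y)\<^sup>2"
  using power2_norm_add_scaled[of x "-1" y] by simp

lemma power2_norm_add:
  fixes x y :: "'h::chilbert_space"
  shows "(norm (x + y))\<^sup>2 = (norm x)\<^sup>2 + 2 * Re (cinner x y) + (norm y)\<^sup>2"
  using power2_norm_add_scaled[of x 1 y] by simp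

lemma bounded_linear_scaleC: "bounded_linear (\<lambda>x::'h::chilbert_space. c *\<^sub>C x)"
proof (rule bounded_linear_intro)
  show "c *\<^sub>C (r *\<^sub>R x) = r *\<^sub>R (c *\<^sub>C x)" for r and x :: 'h
    by (metis mult.commute scaleC_of_real scaleC_scaleC)
  show "norm (c *\<^sub>C x) \<le> norm x * cmod c" for x :: 'h
    by (simp add: norm_scaleC mult.commute)
qed (rule scaleC_add_right)

lemma scaleC_minus_one: "(- 1) *\<^sub>C x = - (x::'h::chilbert_space)"
  using scaleC_of_real[of "-1" x] by simp

text \<open>A bounded functional factoring through a possibly non-closed range is represented by a
  vector in its closure, found by minimising \<open>|P y|\<^sup>2 - 2 Re (\<phi> y)\<close>.\<close>

lemma riesz_on_range:
  fixes P :: "'g::chilbert_space \<Rightarrow> 'h::chilbert_space"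
  assumes P: "linear P" "\<And>c x. P (c *\<^sub>C x) = c *\<^sub>C P x"
    and phi: "linear \<phi>" "\<And>c x. \<phi> (c *\<^sub>C x) = c * \<phi> x"
    and bound: "\<And>y. cmod (\<phi> y) \<le> K * norm (P y)"
  shows "\<exists>v\<in>closure (range P). \<forall>y. \<phi> y = cinner v (P y)"
proof -
  define J where "J y = (norm (P y))\<^sup>2 - 2 * Re (\<phi> y)" for y
  have low: "J y \<ge> - K\<^sup>2" for y
  proof -
    have "Re (\<phi> y) \<le> K * norm (P y)"
      using bound[of y] complex_Re_le_cmod[of "\<phi> y"] by linarith
    moreover have "0 \<le> (norm (P y) - K)\<^sup>2" by simp
    ultimately show ?thesis by (simp add: J_def power2_diff mult.commute)
  qed
  define m where "m = Inf (range J)"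
  have bdd: "bdd_below (range J)" using low by (auto intro!: bdd_belowI)
  have mle: "m \<le> J y" for y unfolding m_def by (rule cInf_lower[OF _ bdd]) simp
  have "\<exists>y. J y < m + inverse (real (Suc n))" for n
  proof -
    have "Inf (range J) < m + inverse (real (Suc n))" by (simp add: m_def)
    then show ?thesis using cInf_less_iff[OF _ bdd] by auto
  qed
  then obtain Y where Y: "\<And>n. J (Y n) < m + inverse (real (Suc n))" by metis
  have Jadd: "J (y + t *\<^sub>R z) = J y + 2 * t * Re (cinner (P y) (P z) - \<phi> z) + t\<^sup>2 * (norm (P z))\<^sup>2" for y z t
    unfolding J_def using power2_norm_add_scaled[of "P y" t "P z"] P(1) phi(1)
    by (simp add: linear_add linear_scale algebra_simps)
  \<comment> \<open>Parallelogram argument: along the segment from y to z, \<open>J\<close> is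
    quadratic with leading coefficient |P y - P z|^2. Comparing its values at the ends and at the
    midpoint, where it is at least m, bounds that coefficient.\<close>
  have par: "(norm (P y - P z))\<^sup>2 \<le> 2 * (J y - m) + 2 * (J z - m)" for y z
  proof -
    have "J (y + (1/2) *\<^sub>R (z - y)) = J y + Re (cinner (P y) (P (z - y)) - \<phi> (z - y)) + (norm (P (z-y)))\<^sup>2 / 4"
      unfolding Jadd by (simp add: power_divide)
    moreover have "J (y + 1 *\<^sub>R (z - y)) = J y + 2 * Re (cinner (P y) (P (z - y)) - \<phi> (z - y)) + (norm (P (z-y)))\<^sup>2"
      unfolding Jadd by simp
    moreover have "norm (P (z - y)) = norm (P y - P z)"
      using P(1) by (simp add: linear_diff norm_minus_commute)
    moreover have "m \<le> J (y + (1/2) *\<^sub>R (z - y))" by (rule mle)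
    ultimately show ?thesis by simp
  qed
  have "Cauchy (\<lambda>n. P (Y n))"
  proof (rule metric_CauchyI)
    fix e :: real assume e: "e > 0"
    then obtain N where N: "inverse (real (Suc N)) < e\<^sup>2 / 4"
      using reals_Archimedean[of "e\<^sup>2 / 4"] by auto
    have "dist (P (Y i)) (P (Y j)) < e" if "i \<ge> N" "j \<ge> N" for i j
    proof -
      have near: "J (Y k) - m < e\<^sup>2 / 4" if "k \<ge> N" for k
      proof -
        have "inverse (real (Suc k)) \<le> inverse (real (Suc N))"
          using that by (simp add: le_imp_inverse_le)
        then show ?thesis using Y[of k] N by linarith
      qed
      have "(norm (P (Y i) - P (Y j)))\<^sup>2 < e\<^sup>2"
      proof -
        have "2 * (J (Y i) - m) + 2 * (J (Y j) - m) < 2 * (e\<^sup>2 / 4) + 2 * (e\<^sup>2 / 4)"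
          by (intro add_strict_mono mult_strict_left_mono near that) simp_all
        then show ?thesis using par[of "Y i" "Y j"] by simp
      qed
      then show ?thesis using e by (simp add: dist_norm power2_less_imp_less)
    qed
    then show "\<exists>N. \<forall>i\<ge>N. \<forall>j\<ge>N. dist (P (Y i)) (P (Y j)) < e" by blast
  qed
  then obtain v where v: "(\<lambda>n. P (Y n)) \<longlonglongrightarrow> v" using Cauchy_convergent convergent_def by blast
  have vc: "v \<in> closure (range P)"
    unfolding closure_sequential using v by (intro exI[of _ "\<lambda>n. P (Y n)"]) simp
  have re: "Re (cinner v (P z) - \<phi> z) = 0" for z
  proof (rule linear_coeff_zero_if_nonneg)
    fix t :: real
    have "(\<lambda>n. inverse (real (Suc n)) + 2 * t * Re (cinner (P (Y n)) (P z) - \<phi> z) + t\<^sup>2 * (norm (P z))\<^sup>2)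
        \<longlonglongrightarrow> 0 + 2 * t * Re (cinner v (P z) - \<phi> z) + t\<^sup>2 * (norm (P z))\<^sup>2"
      by (intro tendsto_intros cinner.tendsto v LIMSEQ_inverse_real_of_nat)
    moreover have "0 \<le> inverse (real (Suc n)) + 2 * t * Re (cinner (P (Y n)) (P z) - \<phi> z) + t\<^sup>2 * (norm (P z))\<^sup>2" for n
      using mle[of "Y n + t *\<^sub>R z"] Y[of n] unfolding Jadd by linarith
    ultimately show "0 \<le> 2 * t * Re (cinner v (P z) - \<phi> z) + t\<^sup>2 * (norm (P z))\<^sup>2"
      using LIMSEQ_le_const[of _ _ 0] by fastforce
  qed
  have "\<phi> z = cinner v (P z)" for z
  proof -
    \<comment> \<open>Minimality only controls real parts; replacing z by i z recovers the imaginary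
      part.\<close>
    have "Re (\<i> * (cinner v (P z) - \<phi> z)) = 0"
      using re[of "\<i> *\<^sub>C z"] by (simp add: P phi cinner_scaleC_right algebra_simps)
    then show ?thesis using re[of z] by (simp add: complex_eq_iff)
  qed
  then show ?thesis using vc by blast
qed

section \<open>Bounded operators and adjoints\<close>

lemma bounded_opsD:
  assumes "T \<in> bounded_ops"
  shows "bounded_linear T" "T (c *\<^sub>C x) = c *\<^sub>C T x"
  using assms by (auto simp: bounded_ops_def)

lemma bounded_opsI:
  assumes "\<And>x y. T (x + y) = T x + T y" "\<And>c x. T (c *\<^sub>C x) = c *\<^sub>C T x"
    "\<And>x. norm (T x) \<le> K * norm (x::'h::chilbert_space)"
  shows "T \<in> bounded_ops"
proof -
  have "bounded_linear T"
    by (rule bounded_linear_intro[of T K])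
      (use assms in \<open>auto simp: scaleC_of_real[symmetric] mult.commute\<close>)
  then show ?thesis using assms by (simp add: bounded_ops_def)
qed

lemma bounded_ops_linear:
  assumes "T \<in> bounded_ops"
  shows "T (x + y) = T x + T y" "T (x - y) = T x - T y" "T 0 = 0" "T (- x) = - T x"
    "T (r *\<^sub>R x) = r *\<^sub>R T x" "T (c *\<^sub>C x) = c *\<^sub>C T x"
proof -
  have l: "linear T" using bounded_opsD(1)[OF assms] by (rule bounded_linear.linear)
  show "T (x + y) = T x + T y" "T (x - y) = T x - T y" "T 0 = 0" "T (- x) = - T x"
    "T (r *\<^sub>R x) = r *\<^sub>R T x"
    using l by (auto simp: linear_add linear_diff linear_0 linear_neg linear_scale)
  show "T (c *\<^sub>C x) = c *\<^sub>C T x" using bounded_opsD(2)[OF assms] .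
qed

lemma bounded_ops_bound:
  assumes "T \<in> bounded_ops"
  obtains K where "K > 0" "\<And>x. norm (T x) \<le> K * norm x"
proof -
  from bounded_linear.pos_bounded[OF bounded_opsD(1)[OF assms]]
  obtain K where K: "K > 0" "\<And>x. norm (T x) \<le> norm x * K" by blast
  show thesis by (rule that[OF K(1)]) (metis K(2) mult.commute)
qed

lemma bounded_ops_id: "id \<in> bounded_ops"
  by (rule bounded_opsI[of _ 1]) auto

lemma bounded_ops_comp:
  assumes "S \<in> bounded_ops" "T \<in> bounded_ops" shows "S \<circ> T \<in> bounded_ops"
  using assms bounded_linear_compose[of S T] by (auto simp: bounded_ops_def comp_def)

lemma bounded_ops_add:
  assumes "S \<in> bounded_ops" "T \<in> bounded_ops" shows "(\<lambda>x. S x + T x) \<in> bounded_ops"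
  using assms bounded_linear_add[of S T] by (auto simp: bounded_ops_def scaleC_add_right)

lemma bounded_ops_scaleC:
  assumes "T \<in> bounded_ops" shows "(\<lambda>x. c *\<^sub>C T x) \<in> bounded_ops"
  using assms bounded_linear_compose[OF bounded_linear_scaleC, of T c]
  by (auto simp: bounded_ops_def scaleC_scaleC mult.commute)

lemma cadjoint_eqI:
  assumes "\<And>x y. cinner (T x) y = cinner x (S y)"
  shows "cadjoint T = S"
  unfolding cadjoint_def
proof (rule the_equality)
  show "S' = S" if "\<forall>x y. cinner (T x) y = cinner x (S' y)" for S'
    by (rule ext, rule cinner_left_ext) (use that assms in simp)
qed (simp add: assms)

lemma cadjoint_props:
  assumes T: "T \<in> bounded_ops"
  shows cinner_cadjoint: "cinner (T x) y = cinner x (cadjoint T y)"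
    and cadjoint_bounded_ops: "cadjoint T \<in> bounded_ops"
proof -
  obtain K where K: "K > 0" "\<And>x. norm (T x) \<le> K * norm x"
    using bounded_ops_bound[OF T] by blast
  have "\<exists>v. \<forall>x. cinner y (T x) = cinner v x" for y
  proof -
    have "\<exists>v\<in>closure (range (\<lambda>x::'a. x)). \<forall>x. cinner y (T x) = cinner v x"
    proof (rule riesz_on_range[of _ _ "norm y * K"])
      show "linear (\<lambda>x. cinner y (T x))"
        by (rule linearI) (simp_all add: bounded_ops_linear[OF T] cinner_add_right cinner_scaleR_right)
      show "cmod (cinner y (T x)) \<le> norm y * K * norm x" for x
        using cinner_Cauchy_Schwarz[of y "T x"] mult_left_mono[OF K(2)[of x], of "norm y"] by simp
    qed (auto simp: linear_iff bounded_ops_linear[OF T] cinner_scaleC_right)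
    then show ?thesis by blast
  qed
  then obtain S where S: "\<And>x y. cinner y (T x) = cinner (S y) x" by metis
  have S': "cinner (T x) y = cinner x (S y)" for x y
    by (metis S cinner_commute)
  then have eq: "cadjoint T = S" by (rule cadjoint_eqI)
  show "cinner (T x) y = cinner x (cadjoint T y)" using S' eq by simp
  show "cadjoint T \<in> bounded_ops" unfolding eq
  proof (rule bounded_opsI[of _ K])
    show "S (x + y) = S x + S y" for x y
      by (rule cinner_left_ext) (simp add: S'[symmetric] cinner_add_right)
    show "S (c *\<^sub>C x) = c *\<^sub>C S x" for c x
      by (rule cinner_left_ext) (simp add: S'[symmetric] cinner_scaleC_right)
    show "norm (S y) \<le> K * norm y" for y
    proof (cases "S y = 0")
      case False
      have "(norm (S y))\<^sup>2 = Re (cinner (T (S y)) y)"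
        by (simp add: S' power2_norm_eq_cinner)
      also have "\<dots> \<le> norm (T (S y)) * norm y" by (rule Re_cinner_le)
      also have "\<dots> \<le> K * norm (S y) * norm y" by (rule mult_right_mono) (use K in auto)
      finally have "norm (S y) * norm (S y) \<le> norm (S y) * (K * norm y)"
        by (simp add: power2_eq_square mult_ac)
      then show ?thesis using False by simp
    qed (use K in simp)
  qed
qed

lemma cinner_cadjoint_left:
  assumes "T \<in> bounded_ops" shows "cinner (cadjoint T x) y = cinner x (T y)"
  by (metis assms cinner_cadjoint cinner_commute)

lemma cadjoint_cadjoint:
  assumes "T \<in> bounded_ops" shows "cadjoint (cadjoint T) = T"
  by (rule cadjoint_eqI) (rule cinner_cadjoint_left[OF assms])

lemma cadjoint_comp:
  assumes "S \<in> bounded_ops" "T \<in> bounded_ops"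
  shows "cadjoint (S \<circ> T) = cadjoint T \<circ> cadjoint S"
  by (rule cadjoint_eqI) (simp add: assms cinner_cadjoint)

section \<open>Factorization in a von Neumann algebra\<close>

declare cinner.zero_left [simp] cinner.zero_right [simp]

lemma cinner_closure_range_eq_0:
  assumes "\<And>y. cinner w (P y) = 0" "v \<in> closure (range P)"
  shows "cinner w v = 0"
proof -
  have "closure (range P) \<subseteq> {v. cinner w v = 0}"
    using assms(1) by (intro closure_minimal closed_Collect_eq continuous_intros cinner.continuous_on) auto
  then show ?thesis using assms(2) by auto
qed

text \<open>By continuity the bound may be tested at v itself, where it reads |v|^2 \<le> K
  |v|.\<close>

lemma norm_le_if_closure_range:
  assumes "\<And>y. cmod (cinner v (P y)) \<le> K * norm (P y)" "v \<in> closure (range P)" and K: "0 \<le> K"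
  shows "norm v \<le> K"
proof -
  have "closure (range P) \<subseteq> {w. cmod (cinner v w) \<le> K * norm w}"
    using assms(1) by (intro closure_minimal closed_Collect_le continuous_intros cinner.continuous_on) auto
  then have "cmod (cinner v v) \<le> K * norm v" using assms(2) by auto
  then have "norm v * norm v \<le> K * norm v" by (simp add: cinner_self norm_mult power2_eq_square)
  then show ?thesis using K by (cases "norm v = 0") auto
qed

text \<open>Two candidates p and q differ by a vector orthogonal to both of them, hence to p - q
  itself.\<close>

lemma orth_projI:
  assumes "p \<in> U" "\<And>u. u \<in> U \<Longrightarrow> cinner u (x - p) = 0"
  shows "orth_proj U x = p"
  unfolding orth_proj_def
proof (rule the_equality)
  fix q assume q: "q \<in> U \<and> (\<forall>u\<in>U. cinner u (x - q) = 0)"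
  have "cinner u (p - q) = 0" if "u \<in> U" for u
  proof -
    have "cinner u (p - q) = cinner u (x - q) - cinner u (x - p)"
      by (simp add: cinner.diff_right)
    then show ?thesis using that q assms(2) by simp
  qed
  then have "cinner (p - q) (p - q) = 0"
    using assms(1) q by (simp add: cinner.diff_left)
  then show "q = p" by simp
qed (use assms in auto)

section \<open>Range and null projections, and factorization inside the algebra\<close>

definition range_proj :: "('h::chilbert_space \<Rightarrow> 'h) \<Rightarrow> 'h \<Rightarrow> 'h" where
  "range_proj B = orth_proj (closure (range B))"

text \<open>The null space of B is the orthogonal complement of ran B^*. This form reduces null
  projections to range projections, which Douglas factorization provides;
  \<open>nproj_eq_orth_proj\<close> gives the geometric description.\<close>

definition nproj :: "('h::chilbert_space \<Rightarrow> 'h) \<Rightarrow> 'h \<Rightarrow> 'h" where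
  "nproj B = (\<lambda>x. x - range_proj (cadjoint B) x)"

locale vn_algebra =
  fixes M :: "('h::chilbert_space \<Rightarrow> 'h) set"
  assumes vn_algebra: "von_neumann_algebra M"
begin

lemma bounded: "A \<in> M \<Longrightarrow> A \<in> bounded_ops"
  using vn_algebra by (auto simp: von_neumann_algebra_def)

lemmas op_linear [simp] = bounded_ops_linear[OF bounded]

lemma cadjoint_closed [simp]: "A \<in> M \<Longrightarrow> cadjoint A \<in> M"
  using vn_algebra by (auto simp: von_neumann_algebra_def)

lemma cadjoint_eq: "A \<in> M \<Longrightarrow> cinner (A x) y = cinner x (cadjoint A y)"
  using cinner_cadjoint bounded by blast

lemma cadjoint_eq': "A \<in> M \<Longrightarrow> cinner (cadjoint A x) y = cinner x (A y)"
  using cinner_cadjoint_left bounded by blast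

lemma cadjoint_cadjoint [simp]: "A \<in> M \<Longrightarrow> cadjoint (cadjoint A) = A"
  using cadjoint_cadjoint bounded by blast

text \<open>The bicommutant condition as a membership test: operators defined by a canonical recipe
  pass it because the recipe commutes with the commutant.\<close>

lemma mem_if_commutes:
  assumes "C \<in> bounded_ops" "\<And>T x. T \<in> commutant M \<Longrightarrow> C (T x) = T (C x)"
  shows "C \<in> M"
proof -
  have "C \<in> commutant (commutant M)"
    unfolding commutant_def[of "commutant M"] using assms by (auto simp: fun_eq_iff)
  then show ?thesis using vn_algebra by (simp add: von_neumann_algebra_def)
qed

lemma commutantD:
  assumes "T \<in> commutant M"
  shows "T \<in> bounded_ops" "A \<in> M \<Longrightarrow> A (T x) = T (A x)"
  using assms by (auto simp: commutant_def fun_eq_iff)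

lemma commutant_cadjoint:
  assumes "T \<in> commutant M" shows "cadjoint T \<in> commutant M"
proof -
  note T = commutantD[OF assms]
  have "cadjoint T (A x) = A (cadjoint T x)" if "A \<in> M" for A x
    by (rule cinner_left_ext)
      (simp add: cinner_cadjoint[OF T(1), symmetric] cadjoint_eq'[OF that, symmetric] T(2) that)
  then show ?thesis using cadjoint_bounded_ops[OF T(1)] by (auto simp: commutant_def fun_eq_iff)
qed

lemma id_closed [simp]: "id \<in> M"
  by (rule mem_if_commutes[OF bounded_ops_id]) simp

lemma comp_closed [simp]: "A \<in> M \<Longrightarrow> B \<in> M \<Longrightarrow> A \<circ> B \<in> M"
  by (rule mem_if_commutes) (auto simp: bounded_ops_comp bounded commutantD)

lemma add_closed [simp]: "A \<in> M \<Longrightarrow> B \<in> M \<Longrightarrow> (\<lambda>x. A x + B x) \<in> M"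
  by (rule mem_if_commutes) (auto simp: bounded_ops_add bounded commutantD bounded_ops_linear)

lemma scaleC_closed [simp]: "A \<in> M \<Longrightarrow> (\<lambda>x. c *\<^sub>C A x) \<in> M"
  by (rule mem_if_commutes) (auto simp: bounded_ops_scaleC bounded commutantD bounded_ops_linear)

lemma scaleR_closed [simp]: "A \<in> M \<Longrightarrow> (\<lambda>x. r *\<^sub>R A x) \<in> M"
  using scaleC_closed[of A "of_real r"] by (simp add: scaleC_of_real)

lemma diff_closed [simp]: "A \<in> M \<Longrightarrow> B \<in> M \<Longrightarrow> (\<lambda>x. A x - B x) \<in> M"
  using add_closed[OF _ scaleC_closed[of B "-1"], of A] by (simp add: scaleC_minus_one)

lemma funpow_closed [simp]: "A \<in> M \<Longrightarrow> A ^^ n \<in> M"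
  by (induction n) (auto simp del: comp_apply)

lemma cinner_null_closure_range:
  assumes "B \<in> M" "B z = 0" "v \<in> closure (range (cadjoint B))"
  shows "cinner z v = 0"
  by (rule cinner_closure_range_eq_0[OF _ assms(3)])
    (simp add: cadjoint_eq[OF assms(1), symmetric] assms(2))

text \<open>For fixed x the functional \<open>cinner x (cadjoint A y)\<close> is bounded in terms of
  \<open>cadjoint B y\<close>, so a Riesz vector \<open>C x\<close> represents it. Requiring this
  vector to lie in the closure of ran B^* makes it unique, and linearity, the bound K and
  commutation with the commutant all follow from uniqueness.\<close>

lemma douglas:
  assumes A: "A \<in> M" and B: "B \<in> M"
    and K: "0 \<le> K" and le: "\<And>y. norm (cadjoint A y) \<le> K * norm (cadjoint B y)"
  shows "\<exists>C\<in>M. A = B \<circ> C \<and> range C \<subseteq> closure (range (cadjoint B))"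
proof -
  let ?V = "closure (range (cadjoint B))"
  have "\<exists>v\<in>?V. \<forall>y. cinner x (cadjoint A y) = cinner v (cadjoint B y)" for x
  proof (rule riesz_on_range[of _ _ "norm x * K"])
    show "linear (cadjoint B)" "linear (\<lambda>y. cinner x (cadjoint A y))"
      using A B by (auto intro!: linearI simp: cinner_add_right cinner_scaleR_right)
    show "cmod (cinner x (cadjoint A y)) \<le> norm x * K * norm (cadjoint B y)" for y
      using cinner_Cauchy_Schwarz[of x "cadjoint A y"] mult_left_mono[OF le[of y], of "norm x"]
      by simp
  qed (use A B in \<open>auto simp: cinner_scaleC_right\<close>)
  then obtain C where CV: "\<And>x. C x \<in> ?V"
    and C: "\<And>x y. cinner x (cadjoint A y) = cinner (C x) (cadjoint B y)"
    by metis
  \<comment> \<open>Membership in the closure is relaxed to orthogonality to every vector orthogonal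
    to ran B^*: this condition passes at once to sums and scalar multiples, and via T^* to images
    under the commutant.\<close>
  have uniq: "v = w" if "\<And>y. cinner v (cadjoint B y) = cinner w (cadjoint B y)"
    "\<And>u. (\<And>y. cinner u (cadjoint B y) = 0) \<Longrightarrow> cinner u v = 0"
    "\<And>u. (\<And>y. cinner u (cadjoint B y) = 0) \<Longrightarrow> cinner u w = 0" for v w
  proof -
    have "cinner (v - w) (cadjoint B y) = 0" for y
      using that(1)[of y] by (simp add: cinner.diff_left)
    then have "cinner (v - w) (v - w) = 0"
      using that(2,3)[of "v - w"] by (simp add: cinner.diff_right)
    then show ?thesis by simp
  qed
  have perp: "cinner u (C x) = 0" if "\<And>y. cinner u (cadjoint B y) = 0" for u x
    using cinner_closure_range_eq_0[OF that CV] .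
  have bd: "norm (C x) \<le> K * norm x" for x
  proof (rule norm_le_if_closure_range[OF _ CV])
    show "cmod (cinner (C x) (cadjoint B y)) \<le> K * norm x * norm (cadjoint B y)" for y
      using cinner_Cauchy_Schwarz[of x "cadjoint A y"] mult_left_mono[OF le[of y], of "norm x"]
      by (simp add: C[symmetric] mult_ac)
  qed (simp add: K)
  have CB: "C \<in> bounded_ops"
  proof (rule bounded_opsI[OF _ _ bd])
    show "C (x + y) = C x + C y" for x y
      by (rule uniq) (auto simp: C[symmetric] cinner_add_left cinner_add_right perp)
    show "C (c *\<^sub>C x) = c *\<^sub>C C x" for c x
      by (rule uniq) (auto simp: C[symmetric] cinner_scaleC_left cinner_scaleC_right perp)
  qed
  have "C \<in> M"
  proof (rule mem_if_commutes[OF CB])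
    fix T x assume T: "T \<in> commutant M"
    note T' = commutantD[OF T] and Ts = commutantD[OF commutant_cadjoint[OF T]]
    show "C (T x) = T (C x)"
    proof (rule uniq)
      show "cinner (C (T x)) (cadjoint B y) = cinner (T (C x)) (cadjoint B y)" for y
        using A B by (simp add: C[symmetric] cinner_cadjoint[OF T'(1)] Ts(2)[symmetric])
      show "cinner u (T (C x)) = 0" if u: "\<And>y. cinner u (cadjoint B y) = 0" for u
      proof -
        \<comment> \<open>T commutes with B^*, so T^* u is again orthogonal to ran B^*.\<close>
        have "cinner (cadjoint T u) (C x) = 0"
        proof (rule perp)
          show "cinner (cadjoint T u) (cadjoint B y) = 0" for y
            using B by (simp add: cinner_cadjoint_left[OF T'(1)] T'(2)[symmetric] u)
        qed
        then show ?thesis by (simp add: cinner_cadjoint_left[OF T'(1)])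
      qed
    qed (rule perp)
  qed
  moreover have "A x = B (C x)" for x
  proof (rule cinner_left_ext)
    fix z
    show "cinner z (A x) = cinner z (B (C x))"
      using C[of x z] A B by (metis cadjoint_eq cinner_commute)
  qed
  ultimately show ?thesis using CV by (intro bexI[of _ C]) auto
qed

text \<open>Factor B^* through itself: B^* = B^* P with ran P in the closure of ran B. Then B^*
  kills x - P x, so x - P x is orthogonal to that closure and P is the projection.\<close>

lemma range_proj:
  assumes "B \<in> M"
  shows range_proj_closed: "range_proj B \<in> M"
    and range_proj_in: "range_proj B x \<in> closure (range B)"
    and range_proj_orth: "u \<in> closure (range B) \<Longrightarrow> cinner u (x - range_proj B x) = 0"
proof -
  obtain P where P: "P \<in> M" "cadjoint B = cadjoint B \<circ> P" "range P \<subseteq> closure (range B)"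
    using douglas[of "cadjoint B" "cadjoint B" 1] assms by auto
  have orth: "cinner u (x - P x) = 0" if "u \<in> closure (range B)" for u x
  proof -
    have "cadjoint B (x - P x) = 0"
      using assms P(2) by (simp add: fun_eq_iff)
    then have "cinner (x - P x) u = 0"
      using cinner_null_closure_range[of "cadjoint B" "x - P x" u] assms that by simp
    then show ?thesis by (metis cinner_commute complex_cnj_zero)
  qed
  have eq: "range_proj B = P"
    unfolding range_proj_def by (rule ext, rule orth_projI) (use P(3) orth in auto)
  show "range_proj B \<in> M" "range_proj B x \<in> closure (range B)"
    "u \<in> closure (range B) \<Longrightarrow> cinner u (x - range_proj B x) = 0"
    unfolding eq using P orth by auto
qed

lemma nproj_closed [simp]: "B \<in> M \<Longrightarrow> nproj B \<in> M"
  unfolding nproj_def using diff_closed[OF id_closed range_proj_closed[of "cadjoint B"]] by simp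

lemma nproj_null [simp]:
  assumes "B \<in> M" shows "B (nproj B x) = 0"
proof (rule cinner_left_ext)
  fix z
  have "cinner (cadjoint B z) (x - range_proj (cadjoint B) x) = 0"
    using assms closure_subset[of "range (cadjoint B)"] by (intro range_proj_orth) auto
  then show "cinner z (B (nproj B x)) = cinner z 0"
    unfolding nproj_def using assms cadjoint_eq' by simp
qed

lemma diff_nproj_in: "B \<in> M \<Longrightarrow> x - nproj B x \<in> closure (range (cadjoint B))"
  by (simp add: nproj_def range_proj_in)

lemma nproj_orth:
  assumes "B \<in> M" "B u = 0" shows "cinner u (x - nproj B x) = 0"
  by (rule cinner_null_closure_range[OF assms diff_nproj_in[OF assms(1)]])

lemma nproj_eq_orth_proj: "B \<in> M \<Longrightarrow> nproj B = orth_proj (op_null B)"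
  by (rule ext, rule orth_projI[symmetric]) (auto simp: op_null_def nproj_orth)

lemma nproj_fixes:
  assumes "B \<in> M" "B u = 0" shows "nproj B u = u"
proof -
  have "cinner (u - nproj B u) (u - nproj B u) = 0"
    by (rule nproj_orth) (use assms in auto)
  then show ?thesis by simp
qed

lemma cadjoint_nproj:
  assumes "B \<in> M" shows "cadjoint (nproj B) = nproj B"
proof (rule cadjoint_eqI)
  fix x y
  have "cinner (nproj B x) (y - nproj B y) = 0" "cinner (nproj B y) (x - nproj B x) = 0"
    using assms by (auto intro!: nproj_orth)
  then have "cinner (nproj B x) y = cinner (nproj B x) (nproj B y)"
    "cinner (nproj B y) x = cinner (nproj B y) (nproj B x)"
    by (auto simp: cinner.diff_right)
  then show "cinner (nproj B x) y = cinner x (nproj B y)" by (metis cinner_commute)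
qed

text \<open>If A x = B w with |w| \<le> n, then x lies in \<open>E n\<close>; hence these closed
  sets cover the space and one of them contains a ball. Subtracting the centre gives a bound on a
  ball around 0, uniform in y.\<close>

lemma range_subset_imp_bound:
  assumes A: "A \<in> M" and B: "B \<in> M" and sub: "range A \<subseteq> range B"
  shows "\<exists>K\<ge>0. \<forall>y. norm (cadjoint A y) \<le> K * norm (cadjoint B y)"
proof -
  define E where "E n = {x. \<forall>y. cmod (cinner (cadjoint A y) x) \<le> real n * norm (cadjoint B y)}" for n
  have cov: "\<Union> (range E) = UNIV"
  proof -
    have "\<exists>n. x \<in> E n" for x
    proof -
      obtain w where w: "A x = B w" using sub by blast
      obtain n where n: "norm w \<le> real n" using real_arch_simple by blast
      have "cmod (cinner (cadjoint A y) x) \<le> real n * norm (cadjoint B y)" for y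
      proof -
        have "cinner (cadjoint A y) x = cinner (cadjoint B y) w"
          using A B w by (simp add: cadjoint_eq')
        then have "cmod (cinner (cadjoint A y) x) \<le> norm (cadjoint B y) * norm w"
          using cinner_Cauchy_Schwarz by metis
        also have "\<dots> \<le> norm (cadjoint B y) * real n" by (rule mult_left_mono[OF n]) simp
        finally show ?thesis by (simp add: mult.commute)
      qed
      then show ?thesis by (auto simp: E_def)
    qed
    then show ?thesis by blast
  qed
  have clo: "closed (E n)" for n
    unfolding E_def Collect_all_eq
    by (intro closed_INT ballI closed_Collect_le continuous_intros cinner.continuous_on)
  obtain n where "interior (E n) \<noteq> {}"
  proof (rule ccontr)
    assume "\<not> thesis"
    then have e: "interior (E n) = {}" for n using that by blast
    have "Met_TC.mtopology interior_of \<Union> (range E) = {}"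
      by (rule Met_TC.metric_Baire_category_alt)
        (use clo e in \<open>auto simp: complete_UNIV Met_TC.mcomplete_def Met_TC.MCauchy_def\<close>)
    then show False using cov by simp
  qed
  then obtain x0 r where r: "r > 0" "ball x0 r \<subseteq> E n"
    by (metis all_not_in_conv mem_interior)
  have small: "cmod (cinner (cadjoint A y) x) \<le> 2 * real n * norm (cadjoint B y)" if "norm x < r" for x y
  proof -
    have "x0 + x \<in> E n" "x0 \<in> E n"
      using r that by (auto simp: subset_iff dist_norm)
    then have "cmod (cinner (cadjoint A y) (x0 + x)) \<le> real n * norm (cadjoint B y)"
      "cmod (cinner (cadjoint A y) x0) \<le> real n * norm (cadjoint B y)"
      by (auto simp: E_def)
    moreover have "cinner (cadjoint A y) x = cinner (cadjoint A y) (x0 + x) - cinner (cadjoint A y) x0"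
      by (simp add: cinner_add_right)
    ultimately show ?thesis
      using norm_triangle_ineq4[of "cinner (cadjoint A y) (x0 + x)" "cinner (cadjoint A y) x0"] by simp
  qed
  \<comment> \<open>Test \<open>small\<close> at the multiple of a = A^* y of length r/2: this gives
    r |a| / 2 \<le> 2 n |B^* y|, whence the 4 n / r.\<close>
  have "norm (cadjoint A y) \<le> (4 * real n / r) * norm (cadjoint B y)" for y
  proof (cases "cadjoint A y = 0")
    case False
    define a where "a = cadjoint A y"
    have a: "norm a > 0" using False by (simp add: a_def)
    have "cmod (cinner a ((r / (2 * norm a)) *\<^sub>R a)) \<le> 2 * real n * norm (cadjoint B y)"
      unfolding a_def by (rule small) (use False r in simp)
    also have "cinner a ((r / (2 * norm a)) *\<^sub>R a) = complex_of_real (r * norm a / 2)"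
      using a by (simp add: cinner_scaleR_right cinner_self scaleR_conv_of_real power2_eq_square)
    also have "cmod \<dots> = r * norm a / 2" using r by (simp add: norm_mult)
    finally show ?thesis using r by (simp add: a_def field_simps)
  qed (use r in simp)
  then show ?thesis using r by (intro exI[of _ "4 * real n / r"]) simp
qed

lemma range_subset_imp_factor:
  assumes "A \<in> M" "B \<in> M" "range A \<subseteq> range B"
  shows "\<exists>C\<in>M. A = B \<circ> C"
  using range_subset_imp_bound[OF assms] douglas[OF assms(1,2)] by blast

end

section \<open>Square roots and polar decomposition of rows\<close>

text \<open>The power series of \<open>1 - sqrt (1 - t)\<close>, whose square is \<open>2 (1 - sqrt (1 - t)) - t\<close>.\<close>

fun sqrt_coeff :: "nat \<Rightarrow> real" where
  "sqrt_coeff 0 = 0"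
| "sqrt_coeff (Suc n) = (of_bool (n = 0) + (\<Sum>i<n. sqrt_coeff (Suc i) * sqrt_coeff (n - i))) / 2"

declare sqrt_coeff.simps(2) [simp del]

lemma sqrt_coeff_nonneg: "0 \<le> sqrt_coeff n"
proof (induction n rule: less_induct)
  case (less n)
  show ?case
  proof (cases n)
    case (Suc m)
    have "0 \<le> (\<Sum>i<m. sqrt_coeff (Suc i) * sqrt_coeff (m - i))"
      using less Suc by (intro sum_nonneg mult_nonneg_nonneg) auto
    then show ?thesis unfolding Suc by (subst sqrt_coeff.simps(2)) simp
  qed simp
qed

text \<open>Coefficient form of f^2 = 2 f - t. The two extreme terms of the Cauchy product vanish
  with \<open>sqrt_coeff 0\<close>, leaving the sum in the recursion.\<close>

lemma sqrt_coeff_convolution: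
  "(\<Sum>i\<le>n. sqrt_coeff i * sqrt_coeff (n - i)) = 2 * sqrt_coeff n - of_bool (n = 1)"
proof (cases n)
  case (Suc m)
  have "(\<Sum>i\<le>n. sqrt_coeff i * sqrt_coeff (n - i)) = (\<Sum>i\<le>m. sqrt_coeff (Suc i) * sqrt_coeff (m - i))"
    unfolding Suc by (subst sum.atMost_Suc_shift) simp
  also have "\<dots> = (\<Sum>i<m. sqrt_coeff (Suc i) * sqrt_coeff (m - i))"
    by (simp flip: lessThan_Suc_atMost)
  finally show ?thesis unfolding Suc sqrt_coeff.simps(2)[of m] by simp
qed simp

text \<open>The partial sums satisfy 2 s(n+1) \<le> 1 + s(n)^2, and the fixed point 1 of s \<mapsto>
  (1 + s^2)/2 traps them.\<close>

lemma sum_sqrt_coeff_le_1: "(\<Sum>i\<le>n. sqrt_coeff i) \<le> 1"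
proof (induction n)
  case (Suc n)
  let ?c = sqrt_coeff
  have "2 * (\<Sum>m\<le>Suc n. ?c m) = (\<Sum>m\<le>Suc n. of_bool (m = 1) + (\<Sum>i\<le>m. ?c i * ?c (m - i)))"
    by (simp only: sqrt_coeff_convolution sum_distrib_left) simp
  also have "\<dots> = (\<Sum>m\<le>Suc n. of_bool (m = 1)) + (\<Sum>m\<le>Suc n. \<Sum>i\<le>m. ?c i * ?c (m - i))"
    by (rule sum.distrib)
  also have "(\<Sum>m\<le>Suc n. of_bool (m = 1)) = (1::real)"
    by (simp add: sum.delta' of_bool_def)
  also have "(\<Sum>m\<le>Suc n. \<Sum>i\<le>m. ?c i * ?c (m - i)) = (\<Sum>(i, j)\<in>{(i, j). i + j \<le> Suc n}. ?c i * ?c j)"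
    by (rule sum.triangle_reindex_eq[symmetric])
  also have "\<dots> \<le> (\<Sum>(i, j)\<in>{..n} \<times> {..n}. ?c i * ?c j)"
  proof -
    have fin: "finite {(i, j). i + j \<le> Suc n}"
      by (rule finite_subset[of _ "{..Suc n} \<times> {..Suc n}"]) auto
    have "(\<Sum>(i, j)\<in>{(i, j). i + j \<le> Suc n}. ?c i * ?c j)
        = (\<Sum>(i, j)\<in>{(i, j). i + j \<le> Suc n} \<inter> {..n} \<times> {..n}. ?c i * ?c j)"
    proof (rule sum.mono_neutral_right[OF fin])
      show "\<forall>p\<in>{(i, j). i + j \<le> Suc n} - {(i, j). i + j \<le> Suc n} \<inter> {..n} \<times> {..n}.
              (case p of (i, j) \<Rightarrow> ?c i * ?c j) = 0"
      proof
        fix p assume "p \<in> {(i, j). i + j \<le> Suc n} - {(i, j). i + j \<le> Suc n} \<inter> {..n} \<times> {..n}"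
        \<comment> \<open>A pair of total at most n + 1 with one index above n has other index 0,
          where the coefficient vanishes; so the square of side n already holds every nonzero
          term.\<close>
        then obtain i j where p: "p = (i, j)" "i + j \<le> Suc n" "i > n \<or> j > n" by (cases p) auto
        then have "i = 0 \<or> j = 0" by linarith
        then show "(case p of (i, j) \<Rightarrow> ?c i * ?c j) = 0" using p by auto
      qed
    qed auto
    also have "\<dots> \<le> (\<Sum>(i, j)\<in>{..n} \<times> {..n}. ?c i * ?c j)"
      by (rule sum_mono2) (auto intro!: mult_nonneg_nonneg sqrt_coeff_nonneg)
    finally show ?thesis .
  qed
  also have "\<dots> = (\<Sum>i\<le>n. ?c i) * (\<Sum>i\<le>n. ?c i)"
    by (simp add: sum_product sum.cartesian_product)
  also have "\<dots> \<le> 1"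
    by (rule mult_le_one[OF Suc.IH sum_nonneg Suc.IH]) (rule sqrt_coeff_nonneg)
  finally show ?case by simp
qed simp

lemma sum_sqrt_coeff_lessThan_le_1: "(\<Sum>i<n. sqrt_coeff i) \<le> 1"
  using sum_sqrt_coeff_le_1[of "n - 1"] by (cases n) (simp_all add: lessThan_Suc_atMost)

lemma summable_sqrt_coeff: "summable sqrt_coeff"
  using sqrt_coeff_nonneg sum_sqrt_coeff_lessThan_le_1 by (rule summableI_nonneg_bounded)

lemma suminf_sqrt_coeff_le_1: "suminf sqrt_coeff \<le> 1"
  using summable_sqrt_coeff sum_sqrt_coeff_lessThan_le_1 by (rule suminf_le_const)

section \<open>The series 1 - sqrt (1 - T) of a contraction T\<close>

locale contraction =
  fixes T :: "'h::chilbert_space \<Rightarrow> 'h"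
  assumes bounded_T: "T \<in> bounded_ops" and norm_le: "norm (T x) \<le> norm x"
begin

lemma funpow_bounded_ops: "T ^^ n \<in> bounded_ops"
  by (induction n) (auto simp: bounded_ops_comp[OF bounded_T] bounded_ops_id[unfolded id_def] simp del: comp_apply)

lemma norm_funpow_le: "norm ((T ^^ n) x) \<le> norm x"
proof (induction n)
  case (Suc n)
  then show ?case using norm_le[of "(T ^^ n) x"] by simp
qed simp

definition sqrt_series :: "'h \<Rightarrow> 'h" where
  "sqrt_series x = (\<Sum>n. sqrt_coeff n *\<^sub>R (T ^^ n) x)"

lemma norm_sqrt_term_le: "norm (sqrt_coeff n *\<^sub>R (T ^^ n) x) \<le> sqrt_coeff n * norm x"
  by (simp add: sqrt_coeff_nonneg mult_left_mono norm_funpow_le)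

lemma summable_norm_sqrt_series: "summable (\<lambda>n. norm (sqrt_coeff n *\<^sub>R (T ^^ n) x))"
  by (rule summable_comparison_test'[OF summable_mult2[OF summable_sqrt_coeff], of 0 _ "norm x"])
    (use norm_sqrt_term_le in auto)

lemma sqrt_series_sums: "(\<lambda>n. sqrt_coeff n *\<^sub>R (T ^^ n) x) sums sqrt_series x"
  unfolding sqrt_series_def
  by (rule summable_sums[OF summable_norm_cancel[OF summable_norm_sqrt_series]])

lemma sqrt_series_has_sum: "((\<lambda>n. sqrt_coeff n *\<^sub>R (T ^^ n) x) has_sum sqrt_series x) UNIV"
  by (rule norm_summable_imp_has_sum[OF summable_norm_sqrt_series sqrt_series_sums])

text \<open>Serves twice: for A a complex scalar it gives complex homogeneity, for A in the
  commutant it gives membership in the algebra.\<close>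

lemma sqrt_series_commute:
  assumes "A \<in> bounded_ops" "\<And>x. A (T x) = T (A x)"
  shows "A (sqrt_series x) = sqrt_series (A x)"
proof -
  have "A ((T ^^ n) x) = (T ^^ n) (A x)" for n x
    by (induction n) (auto simp: assms(2))
  then have "(\<lambda>n. sqrt_coeff n *\<^sub>R (T ^^ n) (A x)) sums A (sqrt_series x)"
    using bounded_linear.sums[OF bounded_opsD(1)[OF assms(1)] sqrt_series_sums, of x]
    by (simp add: bounded_ops_linear[OF assms(1)])
  then show ?thesis using sqrt_series_sums sums_unique2 by blast
qed

lemma sqrt_series_bounded_ops: "sqrt_series \<in> bounded_ops"
proof (rule bounded_opsI[of _ 1])
  show "sqrt_series (x + y) = sqrt_series x + sqrt_series y" for x y
    using sums_add[OF sqrt_series_sums[of x] sqrt_series_sums[of y]] sqrt_series_sums[of "x + y"]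
    by (simp add: bounded_ops_linear[OF funpow_bounded_ops] scaleR_add_right[symmetric] sums_unique2)
  show "sqrt_series (c *\<^sub>C x) = c *\<^sub>C sqrt_series x" for c x
    by (rule sqrt_series_commute[symmetric])
      (use bounded_ops_scaleC[OF bounded_ops_id, of c] in \<open>auto simp: bounded_ops_linear[OF bounded_T]\<close>)
  show "norm (sqrt_series x) \<le> 1 * norm x" for x
  proof -
    have "norm (sqrt_series x) \<le> (\<Sum>n. norm (sqrt_coeff n *\<^sub>R (T ^^ n) x))"
      unfolding sqrt_series_def by (rule summable_norm[OF summable_norm_sqrt_series])
    also have "\<dots> \<le> (\<Sum>n. sqrt_coeff n * norm x)"
      by (rule suminf_le[OF norm_sqrt_term_le summable_norm_sqrt_series summable_mult2[OF summable_sqrt_coeff]])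
    also have "\<dots> = suminf sqrt_coeff * norm x"
      by (rule suminf_mult2[OF summable_sqrt_coeff, symmetric])
    also have "\<dots> \<le> 1 * norm x"
      by (rule mult_right_mono[OF suminf_sqrt_coeff_le_1]) simp
    finally show ?thesis .
  qed
qed

text \<open>The double family \<open>f\<close> is absolutely summable. Summed by rows it gives the
  iterated series, summed along antidiagonals the Cauchy product evaluated by
  \<open>sqrt_coeff_convolution\<close>.\<close>

lemma sqrt_series_square: "sqrt_series (sqrt_series x) = 2 *\<^sub>R sqrt_series x - T x"
proof -
  let ?c = sqrt_coeff
  define f where "f = (\<lambda>(i, j). (?c i * ?c j) *\<^sub>R (T ^^ (i + j)) x)"
  have "(\<lambda>p. norm (f p)) summable_on UNIV"
  proof (rule nonneg_bdd_above_summable_on)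
    show "bdd_above (sum (\<lambda>p. norm (f p)) ` {F. F \<subseteq> UNIV \<and> finite F})"
    proof (rule bdd_aboveI2)
      fix F :: "(nat \<times> nat) set" assume "F \<in> {F. F \<subseteq> UNIV \<and> finite F}"
      then have F: "finite F" by simp
      \<comment> \<open>Any finite index set sits in a square, whose sum is at most (\<Sum> c)^2 |x|
        \<le> |x|. The inserted 0 keeps the maximum defined for empty F.\<close>
      define n where "n = Max (insert 0 (fst ` F \<union> snd ` F))"
      have sub: "F \<subseteq> {..n} \<times> {..n}"
        using F by (auto simp: n_def intro!: Max_ge) force+
      have "(\<Sum>p\<in>F. norm (f p)) \<le> (\<Sum>p\<in>{..n} \<times> {..n}. norm (f p))"
        by (rule sum_mono2[OF _ sub]) auto
      also have "\<dots> \<le> (\<Sum>(i, j)\<in>{..n} \<times> {..n}. ?c i * ?c j * norm x)"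
        by (rule sum_mono)
          (auto simp: f_def abs_mult sqrt_coeff_nonneg intro!: mult_left_mono norm_funpow_le)
      also have "\<dots> = (\<Sum>(i, j)\<in>{..n} \<times> {..n}. ?c i * ?c j) * norm x"
        by (simp add: sum_distrib_right case_prod_unfold)
      also have "\<dots> = (\<Sum>i\<le>n. ?c i) * (\<Sum>i\<le>n. ?c i) * norm x"
        by (simp add: sum_product sum.cartesian_product)
      also have "\<dots> \<le> 1 * norm x"
        by (intro mult_right_mono mult_le_one sum_sqrt_coeff_le_1 sum_nonneg sqrt_coeff_nonneg) auto
      finally show "(\<Sum>p\<in>F. norm (f p)) \<le> 1 * norm x" .
    qed
  qed auto
  then have "f summable_on UNIV" by (rule abs_summable_summable)
  then have f: "(f has_sum infsum f UNIV) (UNIV \<times> UNIV)" by simp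
  have "((\<lambda>i. ?c i *\<^sub>R (T ^^ i) (sqrt_series x)) has_sum infsum f UNIV) UNIV"
  proof (rule has_sum_SigmaD[OF f])
    fix i
    have "bounded_linear (\<lambda>y. ?c i *\<^sub>R (T ^^ i) y)"
      by (rule bounded_linear_compose[OF bounded_linear_scaleR_right bounded_opsD(1)[OF funpow_bounded_ops]])
    from has_sum_bounded_linear[OF this sqrt_series_has_sum, of x]
    show "((\<lambda>j. f (i, j)) has_sum ?c i *\<^sub>R (T ^^ i) (sqrt_series x)) UNIV"
      by (simp add: f_def bounded_ops_linear[OF funpow_bounded_ops] funpow_add)
  qed
  then have 1: "sqrt_series (sqrt_series x) = infsum f UNIV"
    using sqrt_series_has_sum has_sum_unique by blast
  \<comment> \<open>Regrouping by total degree n = i + j.\<close>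
  have "((\<lambda>(n, i). f (i, n - i)) has_sum infsum f UNIV) (SIGMA n:UNIV. {..n})"
    by (rule has_sum_reindex_bij_witness[where i = "\<lambda>(n, i). (i, n - i)" and j = "\<lambda>(i, j). (i + j, i)"
          and S = "UNIV \<times> UNIV", THEN iffD1, OF _ _ _ _ _ _ f]) auto
  then have "((\<lambda>n. \<Sum>i\<le>n. f (i, n - i)) has_sum infsum f UNIV) UNIV"
    by (rule has_sum_SigmaD) (auto intro!: has_sum_finiteI)
  moreover have "(\<Sum>i\<le>n. f (i, n - i)) = 2 *\<^sub>R (?c n *\<^sub>R (T ^^ n) x) - of_bool (n = 1) *\<^sub>R T x" for n
  proof -
    have "(\<Sum>i\<le>n. f (i, n - i)) = (\<Sum>i\<le>n. ?c i * ?c (n - i)) *\<^sub>R (T ^^ n) x"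
      unfolding scaleR_sum_left by (rule sum.cong) (auto simp: f_def)
    then show ?thesis
      unfolding sqrt_coeff_convolution by (auto simp: scaleR_diff_left)
  qed
  ultimately have "((\<lambda>n. 2 *\<^sub>R (?c n *\<^sub>R (T ^^ n) x) - of_bool (n = 1) *\<^sub>R T x) has_sum infsum f UNIV) UNIV"
    by simp
  moreover have "((\<lambda>n. 2 *\<^sub>R (?c n *\<^sub>R (T ^^ n) x) - of_bool (n = 1) *\<^sub>R T x) has_sum
      (2 *\<^sub>R sqrt_series x - T x)) UNIV"
    unfolding diff_conv_add_uminus
  proof (intro has_sum_add, goal_cases)
    case 1
    show "((\<lambda>n. 2 *\<^sub>R (?c n *\<^sub>R (T ^^ n) x)) has_sum 2 *\<^sub>R sqrt_series x) UNIV"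
      by (rule has_sum_bounded_linear[OF bounded_linear_scaleR_right sqrt_series_has_sum])
  next
    case 2
    show "((\<lambda>n. - (of_bool (n = 1) *\<^sub>R T x)) has_sum - T x) (UNIV :: nat set)"
      by (rule has_sum_finite_neutralI[of "{1}"]) auto
  qed
  ultimately show ?thesis unfolding 1 by (rule has_sum_unique)
qed

end

section \<open>Square roots in the algebra and polar decomposition of a row\<close>

context vn_algebra
begin

text \<open>With R = \<open>sqrt_series\<close>, (1 - R)^2 = 1 - 2 R + R^2 = 1 - T by
  \<open>sqrt_series_square\<close>.\<close>

lemma exists_sqrt_one_minus:
  assumes T: "T \<in> M" and sa: "cadjoint T = T" and le: "\<And>x. norm (T x) \<le> norm x"
  shows "\<exists>S\<in>M. cadjoint S = S \<and> (\<forall>x. S (S x) = x - T x)"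
proof -
  interpret contraction T by unfold_locales (use bounded T le in auto)
  have "sqrt_series \<in> M"
  proof (rule mem_if_commutes[OF sqrt_series_bounded_ops])
    fix A x assume A: "A \<in> commutant M"
    show "sqrt_series (A x) = A (sqrt_series x)"
      by (rule sqrt_series_commute[symmetric]) (rule commutantD[OF A], rule commutantD(2)[OF A T, symmetric])
  qed
  moreover have "cadjoint sqrt_series = sqrt_series"
  proof (rule cadjoint_eqI)
    fix x y
    have pow: "cinner ((T ^^ n) u) v = cinner u ((T ^^ n) v)" for n u v
      by (induction n arbitrary: u v) (use cadjoint_eq[OF T] sa in \<open>auto simp: funpow_swap1\<close>)
    have "(\<lambda>n. cinner (sqrt_coeff n *\<^sub>R (T ^^ n) x) y) sums cinner (sqrt_series x) y"
      by (rule bounded_linear.sums[OF cinner.bounded_linear_left sqrt_series_sums])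
    moreover have "(\<lambda>n. cinner x (sqrt_coeff n *\<^sub>R (T ^^ n) y)) sums cinner x (sqrt_series y)"
      by (rule bounded_linear.sums[OF cinner.bounded_linear_right sqrt_series_sums])
    ultimately show "cinner (sqrt_series x) y = cinner x (sqrt_series y)"
      by (simp add: cinner_scaleR_left cinner_scaleR_right pow sums_unique2)
  qed
  ultimately have C: "sqrt_series \<in> M" "cadjoint sqrt_series = sqrt_series" .
  let ?S = "\<lambda>x. x - sqrt_series x"
  have "?S \<in> M" using diff_closed[OF id_closed C(1)] by simp
  moreover have "cadjoint ?S = ?S"
    by (rule cadjoint_eqI) (simp add: cinner.diff_left cinner.diff_right cadjoint_eq[OF C(1)] C(2))
  moreover have "?S (?S x) = x - T x" for x
    using C(1) by (simp add: sqrt_series_square scaleR_2)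
  ultimately show ?thesis by blast
qed

text \<open>The halves force 2 |H x|^2 \<le> |a^* x|^2 + |b^* x|^2, and the right side is the
  quadratic form of H at x. Beyond contractivity of 1 - H this leaves room for |H x|^2 on the left,
  the surplus that telescopes in \<open>funpow_T_tendsto_0\<close>.\<close>

lemma power2_norm_one_minus_le:
  assumes a: "a \<in> M" and b: "b \<in> M"
    and na: "\<And>x. norm (a x) \<le> norm x / 2" and nb: "\<And>x. norm (b x) \<le> norm x / 2"
    and H: "H = (\<lambda>x. a (cadjoint a x) + b (cadjoint b x))"
  shows "(norm (x - H x))\<^sup>2 + (norm (H x))\<^sup>2 \<le> (norm x)\<^sup>2"
proof -
  let ?p = "norm (cadjoint a x)" and ?q = "norm (cadjoint b x)"
  have "Re (cinner x (H x)) = ?p\<^sup>2 + ?q\<^sup>2"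
    using a b by (simp add: H cinner_add_right cadjoint_eq'[symmetric] power2_norm_eq_cinner)
  then have 1: "(norm (x - H x))\<^sup>2 = (norm x)\<^sup>2 - 2 * (?p\<^sup>2 + ?q\<^sup>2) + (norm (H x))\<^sup>2"
    by (simp add: power2_norm_diff)
  have "norm (H x) \<le> (?p + ?q) / 2"
    unfolding H add_divide_distrib by (rule order_trans[OF norm_triangle_ineq add_mono[OF na nb]])
  then have "(norm (H x))\<^sup>2 \<le> ((?p + ?q) / 2)\<^sup>2" by (rule power_mono) simp
  also have "\<dots> \<le> (?p\<^sup>2 + ?q\<^sup>2) / 2"
    using sum_squares_bound[of ?p ?q] by (simp add: power_divide power2_sum)
  finally have "2 * (norm (H x))\<^sup>2 \<le> ?p\<^sup>2 + ?q\<^sup>2" by simp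
  then show ?thesis
    unfolding 1 distrib_left using zero_le_power2[of ?p] zero_le_power2[of ?q] by linarith
qed

text \<open>The column \<open>(f'\<^sup>*, g'\<^sup>*)\<close> is the partial isometry in the polar decomposition of the
  column \<open>(f\<^sup>*, g\<^sup>*)\<close>, whose absolute value is \<open>S\<close>.\<close>

lemma exists_row_polar_contraction:
  assumes f: "f \<in> M" and g: "g \<in> M"
    and nf: "\<And>x. norm (f x) \<le> norm x / 2" and ng: "\<And>x. norm (g x) \<le> norm x / 2"
  obtains S f' g' where "S \<in> M" "f' \<in> M" "g' \<in> M" "f = S \<circ> f'" "g = S \<circ> g'"
    "S = (\<lambda>x. f (cadjoint f' x) + g (cadjoint g' x))"
    "op_null S \<subseteq> op_null (cadjoint f')" "op_null S \<subseteq> op_null (cadjoint g')"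
    "(\<lambda>x. f' (cadjoint f' (f' x)) + g' (cadjoint g' (f' x))) = f'"
    "(\<lambda>x. f' (cadjoint f' (g' x)) + g' (cadjoint g' (g' x))) = g'"
proof -
  define H where "H = (\<lambda>x. f (cadjoint f x) + g (cadjoint g x))"
  have HM: "H \<in> M"
    unfolding H_def using add_closed[of "f \<circ> cadjoint f" "g \<circ> cadjoint g"] f g by simp
  have Hsa: "cinner (H x) y = cinner x (H y)" for x y
    using f g by (simp add: H_def cinner_add_left cinner_add_right cadjoint_eq cadjoint_eq')
  \<comment> \<open>The square root of H = f f^* + g g^* is taken as that of 1 - (1 - H), with 1 - H
    a contraction.\<close>
  have "\<exists>S\<in>M. cadjoint S = S \<and> (\<forall>x. S (S x) = x - (x - H x))"
  proof (rule exists_sqrt_one_minus)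
    show "(\<lambda>x. x - H x) \<in> M" using diff_closed[OF id_closed HM] by simp
    show "cadjoint (\<lambda>x. x - H x) = (\<lambda>x. x - H x)"
      by (rule cadjoint_eqI) (simp add: Hsa cinner.diff_left cinner.diff_right)
    show "norm (x - H x) \<le> norm x" for x
    proof (rule power2_le_imp_le)
      show "(norm (x - H x))\<^sup>2 \<le> (norm x)\<^sup>2"
        using power2_norm_one_minus_le[OF f g nf ng H_def, of x] zero_le_power2[of "norm (H x)"]
        by linarith
    qed simp
  qed
  then obtain S where S: "S \<in> M" "cadjoint S = S" and SS: "\<And>x. S (S x) = H x" by auto
  have Sy: "(norm (S y))\<^sup>2 = (norm (cadjoint f y))\<^sup>2 + (norm (cadjoint g y))\<^sup>2" for y
  proof -
    have "cinner (S y) (S y) = cinner y (H y)"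
      using cadjoint_eq[OF S(1), of y "S y"] by (simp add: S(2) SS)
    then show ?thesis
      using f g by (simp add: H_def power2_norm_eq_cinner cinner_add_right cadjoint_eq')
  qed
  \<comment> \<open>Since |S y|^2 = |f^* y|^2 + |g^* y|^2, Douglas applies to both entries with
    constant 1.\<close>
  have "norm (cadjoint f y) \<le> 1 * norm (cadjoint S y)" "norm (cadjoint g y) \<le> 1 * norm (cadjoint S y)" for y
    unfolding S(2) using Sy[of y] by (auto intro!: power2_le_imp_le[OF _ norm_ge_zero])
  then obtain f' g' where f': "f' \<in> M" "f = S \<circ> f'" "range f' \<subseteq> closure (range S)"
    and g': "g' \<in> M" "g = S \<circ> g'" "range g' \<subseteq> closure (range S)"
    using douglas[OF f S(1) zero_le_one] douglas[OF g S(1) zero_le_one] S(2) by metis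
  have fadj: "cadjoint f = cadjoint f' \<circ> S" "cadjoint g = cadjoint g' \<circ> S"
    using f' g' S bounded cadjoint_comp by metis+
  have orth: "cinner z (f' x) = 0" "cinner z (g' x) = 0" "cinner z (S x) = 0" if "S z = 0" for x z
    by (rule cinner_null_closure_range[OF S(1) that];
        use f'(3) g'(3) closure_subset[of "range S"] S(2) in auto)+
  \<comment> \<open>\<open>Q\<close> is the product of the row (f', g') with its adjoint, in effect
    the projection onto the closure of ran S. This is used through Q S = S and S Q = S.\<close>
  define Q where "Q x = f' (cadjoint f' x) + g' (cadjoint g' x)" for x
  have SQS: "S (S x) = S (Q (S x))" for x
  proof -
    have "S (Q (S x)) = f (cadjoint f x) + g (cadjoint g x)"
      unfolding Q_def fadj using S(1) f'(2) g'(2) by simp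
    then show ?thesis by (simp add: SS H_def)
  qed
  \<comment> \<open>v - Q v lies in the null space of S, to which both v and Q v are
    orthogonal.\<close>
  have eq_Q: "v = Q v" if "S v = S (Q v)" "\<And>z. S z = 0 \<Longrightarrow> cinner z v = 0" for v
  proof -
    have "cinner (v - Q v) (v - Q v) = 0"
      unfolding cinner.diff_right[of _ v] Q_def[of v] cinner_add_right
      using that orth[of "v - Q v"] S(1) by (simp add: Q_def)
    then show ?thesis by simp
  qed
  have QS: "Q (S x) = S x" for x
    using eq_Q[OF SQS] orth(3) by metis
  \<comment> \<open>The adjoint of Q S = S, both factors being self-adjoint.\<close>
  have SQ: "S (Q x) = S x" for x
  proof (rule cinner_left_ext)
    fix z
    have "cinner z (S (Q x)) = cinner (Q (S z)) x"
      using S f' g' by (simp add: Q_def cadjoint_eq cadjoint_eq' cinner_add_left cinner_add_right)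
    then show "cinner z (S (Q x)) = cinner z (S x)" using S by (simp add: QS cadjoint_eq)
  qed
  have SE: "S = (\<lambda>x. f (cadjoint f' x) + g (cadjoint g' x))"
    using SQ S(1) by (auto simp: f'(2) g'(2) Q_def)
  have null: "op_null S \<subseteq> op_null (cadjoint f')" "op_null S \<subseteq> op_null (cadjoint g')"
  proof -
    have "cadjoint u x = 0" if "u \<in> M" "\<And>y. cinner x (u y) = 0" for u x
      using cadjoint_eq'[OF that(1), of x "cadjoint u x"] that(2) by simp
    then show "op_null S \<subseteq> op_null (cadjoint f')" "op_null S \<subseteq> op_null (cadjoint g')"
      unfolding op_null_def using orth(1,2) f'(1) g'(1) by blast+
  qed
  have fixed: "(\<lambda>x. f' (cadjoint f' (f' x)) + g' (cadjoint g' (f' x))) = f'"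
    "(\<lambda>x. f' (cadjoint f' (g' x)) + g' (cadjoint g' (g' x))) = g'"
    unfolding Q_def[symmetric]
    by (rule ext, rule eq_Q[symmetric], simp only: SQ, erule orth)+
  show thesis
    by (rule that) (fact S(1) f'(1,2) g'(1,2) SE null fixed)+
qed

text \<open>Scaling the row by 1/r makes it small without changing its partial isometry; the
  absolute value S absorbs the factor r.\<close>

lemma exists_row_polar:
  assumes f: "f \<in> M" and g: "g \<in> M"
  obtains S f' g' where "S \<in> M" "f' \<in> M" "g' \<in> M" "f = S \<circ> f'" "g = S \<circ> g'"
    "S = (\<lambda>x. f (cadjoint f' x) + g (cadjoint g' x))"
    "op_null S \<subseteq> op_null (cadjoint f')" "op_null S \<subseteq> op_null (cadjoint g')"
    "(\<lambda>x. f' (cadjoint f' (f' x)) + g' (cadjoint g' (f' x))) = f'"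
    "(\<lambda>x. f' (cadjoint f' (g' x)) + g' (cadjoint g' (g' x))) = g'"
proof -
  obtain K L where K: "K > 0" "\<And>x. norm (f x) \<le> K * norm x" and L: "L > 0" "\<And>x. norm (g x) \<le> L * norm x"
    using bounded_ops_bound[OF bounded[OF f]] bounded_ops_bound[OF bounded[OF g]] by metis
  define r where "r = 2 * max K L"
  have r: "r > 0" using K(1) by (simp add: r_def)
  have small: "norm ((1 / r) *\<^sub>R u x) \<le> norm x / 2" if "\<And>x. norm (u x) \<le> L' * norm x" "L' \<le> max K L" for u x L'
  proof -
    have "norm (u x) \<le> max K L * norm x"
      using that(1)[of x] mult_right_mono[OF that(2) norm_ge_zero[of x]] by linarith
    then show ?thesis using r by (simp add: field_simps r_def)
  qed
  define a where "a = (\<lambda>x. (1 / r) *\<^sub>R f x)"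
  define b where "b = (\<lambda>x. (1 / r) *\<^sub>R g x)"
  have ab: "a \<in> M" "b \<in> M" "norm (a x) \<le> norm x / 2" "norm (b x) \<le> norm x / 2" for x
    using small[of f K] small[of g L] K L f g unfolding a_def b_def by auto
  show thesis
  proof (rule exists_row_polar_contraction[OF ab])
    fix S f' g'
    assume S: "S \<in> M" and fg': "f' \<in> M" "g' \<in> M" "a = S \<circ> f'" "b = S \<circ> g'"
      and SE: "S = (\<lambda>x. a (cadjoint f' x) + b (cadjoint g' x))"
      and null: "op_null S \<subseteq> op_null (cadjoint f')" "op_null S \<subseteq> op_null (cadjoint g')"
      and fixed: "(\<lambda>x. f' (cadjoint f' (f' x)) + g' (cadjoint g' (f' x))) = f'"
        "(\<lambda>x. f' (cadjoint f' (g' x)) + g' (cadjoint g' (g' x))) = g'"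
    have fg: "f = (\<lambda>x. r *\<^sub>R a x)" "g = (\<lambda>x. r *\<^sub>R b x)"
      using r by (auto simp: a_def b_def)
    let ?S = "\<lambda>x. r *\<^sub>R S x"
    have nS: "op_null ?S = op_null S" using r by (simp add: op_null_def)
    show thesis
    proof (rule that[of ?S f' g'])
      show "f = ?S \<circ> f'" "g = ?S \<circ> g'"
        by (simp_all add: fg fg'(3,4) comp_def)
      show "?S = (\<lambda>x. f (cadjoint f' x) + g (cadjoint g' x))"
        by (subst SE) (simp add: fg scaleR_add_right)
      show "op_null ?S \<subseteq> op_null (cadjoint f')" "op_null ?S \<subseteq> op_null (cadjoint g')"
        using null by (simp_all add: nS)
      show "?S \<in> M" using S by simp
    qed (fact fg' fixed)+
  qed
qed

end

section \<open>Normal homomorphisms and null spaces\<close>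

text \<open>U = S - R is self-adjoint with vanishing quadratic form; at x + U x that form equals 2
  |U x|^2.\<close>

lemma op_le_antisym:
  assumes S: "S \<in> bounded_ops" "cadjoint S = S" and R: "R \<in> bounded_ops" "cadjoint R = R"
    and le: "op_le S R" "op_le R S"
  shows "S = R"
proof (rule ext)
  fix x
  define U where "U x = S x - R x" for x
  have q: "Re (cinner y (U y)) = 0" for y
    using le unfolding op_le_def U_def cinner.diff_right by (simp add: antisym)
  have sa: "cinner (U y) z = cinner y (U z)" for y z
    using cinner_cadjoint[OF S(1)] cinner_cadjoint[OF R(1)] S R
    by (simp add: U_def cinner.diff_left cinner.diff_right)
  have "U (y + z) = U y + U z" for y z
    by (simp add: U_def bounded_ops_linear[OF S(1)] bounded_ops_linear[OF R(1)])
  then have "Re (cinner x (U (U x))) + Re (cinner (U x) (U x)) = 0"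
    using q[of "x + U x"] q[of x] q[of "U x"] by (simp add: cinner_add_left cinner_add_right)
  then have "(norm (U x))\<^sup>2 = 0"
    using sa[of x "U x"] by (simp add: power2_norm_eq_cinner)
  then show "S x = R x" by (simp add: U_def)
qed

context vn_algebra
begin

lemma op_is_lub_unique:
  assumes "op_is_lub M D S" "op_is_lub M D R"
  shows "S = R"
proof (rule op_le_antisym)
  have "S \<in> M" "R \<in> M" using assms by (auto simp: op_is_lub_def selfadjoint_part_def)
  then show "S \<in> bounded_ops" "R \<in> bounded_ops" by (auto intro: bounded)
qed (use assms in \<open>auto simp: op_is_lub_def selfadjoint_part_def\<close>)

end

text \<open>The powers of \<open>T = 1 - 2 s\<^sup>2 B\<^sup>*B\<close> decrease to the projection onto the null space of \<open>B\<close>.\<close>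

locale null_power = vn_algebra M for M :: "('a::chilbert_space \<Rightarrow> 'a) set" +
  fixes B :: "'a \<Rightarrow> 'a" and s :: real and T H :: "'a \<Rightarrow> 'a"
  assumes B: "B \<in> M" and s: "s \<noteq> 0" and small: "norm (s *\<^sub>R cadjoint B x) \<le> norm x / 2"
  defines H: "H \<equiv> (\<lambda>x. (2 * s\<^sup>2) *\<^sub>R cadjoint B (B x))" and T: "T \<equiv> (\<lambda>x. x - H x)"
begin

lemma H_closed: "H \<in> M"
  unfolding H using scaleR_closed[OF comp_closed[OF cadjoint_closed[OF B] B]] by simp

lemma T_closed: "T \<in> M"
  unfolding T using diff_closed[OF id_closed H_closed] by simp

lemma cadjoint_H: "cadjoint H = H"
  by (rule cadjoint_eqI)
    (use B in \<open>simp add: H cinner_scaleR_left cinner_scaleR_right cadjoint_eq cadjoint_eq'\<close>)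

lemma T_selfadjoint: "cinner (T x) y = cinner x (T y)"
  using cadjoint_eq[OF H_closed] by (simp add: T cinner.diff_left cinner.diff_right cadjoint_H)

lemma power2_norm_T: "(norm (T x))\<^sup>2 + (norm (H x))\<^sup>2 \<le> (norm x)\<^sup>2"
proof -
  let ?a = "\<lambda>x. s *\<^sub>R cadjoint B x"
  have "cadjoint ?a = (\<lambda>x. s *\<^sub>R B x)"
    by (rule cadjoint_eqI) (use B in \<open>simp add: cinner_scaleR_left cinner_scaleR_right cadjoint_eq'\<close>)
  \<comment> \<open>The factor 2 in \<open>H\<close> makes it the two-term sum with both entries s
    B^*, so the estimate for rows applies.\<close>
  then have "H = (\<lambda>x. ?a (cadjoint ?a x) + ?a (cadjoint ?a x))"
    using B by (simp add: H fun_eq_iff scaleR_2[symmetric] power2_eq_square)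
  from power2_norm_one_minus_le[OF _ _ small small this] show ?thesis
    using B by (simp add: T)
qed

lemma norm_T_le: "norm (T x) \<le> norm x"
proof (rule power2_le_imp_le)
  show "(norm (T x))\<^sup>2 \<le> (norm x)\<^sup>2"
    using power2_norm_T[of x] zero_le_power2[of "norm (H x)"] by linarith
qed simp

lemma funpow_T_selfadjoint: "cinner ((T ^^ n) x) y = cinner x ((T ^^ n) y)"
  by (induction n arbitrary: x y) (simp_all add: T_selfadjoint funpow_swap1)

lemma cinner_funpow_T: "cinner x ((T ^^ (2 * n)) x) = complex_of_real ((norm ((T ^^ n) x))\<^sup>2)"
  by (simp add: mult_2 funpow_add funpow_T_selfadjoint[symmetric] cinner_self)

lemma norm_funpow_T_mono: "m \<le> n \<Longrightarrow> norm ((T ^^ n) x) \<le> norm ((T ^^ m) x)"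
proof (induction n rule: dec_induct)
  case (step n)
  then show ?case using norm_T_le[of "(T ^^ n) x"] by simp
qed simp

lemma H_funpow_T: "H ((T ^^ n) x) = (T ^^ n) (H x)"
proof -
  have "H (T y) = T (H y)" for y
    using H_closed by (simp add: T)
  then show ?thesis by (induction n) simp_all
qed

lemma null_H: "op_null H = op_null B"
proof -
  have "B x = 0" if "H x = 0" for x
  proof -
    have "cinner x (H x) = (2 * s\<^sup>2) *\<^sub>R cinner (B x) (B x)"
      using B by (simp add: H cinner_scaleR_right cadjoint_eq)
    then show ?thesis using that s by simp
  qed
  then show ?thesis using B by (auto simp: op_null_def H)
qed

text \<open>On ran H, |T^n H z|^2 is at most |T^n z|^2 - |T^(n+1) z|^2, a difference of consecutive
  terms of a convergent sequence. As the powers are contractions, convergence extends to the closure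
  of ran H, the complement of null(B).\<close>

lemma funpow_T_tendsto_0: "(\<lambda>n. (T ^^ n) (x - nproj B x)) \<longlonglongrightarrow> 0"
proof -
  have rng: "(\<lambda>n. (T ^^ n) (H z)) \<longlonglongrightarrow> 0" for z
  proof -
    let ?a = "\<lambda>n. (norm ((T ^^ n) z))\<^sup>2"
    have "decseq ?a"
      by (intro decseq_SucI power_mono norm_funpow_T_mono) auto
    then obtain L where L: "?a \<longlonglongrightarrow> L"
      using decseq_convergent[of ?a 0] by auto
    have "(\<lambda>n. ?a n - ?a (Suc n)) \<longlonglongrightarrow> L - L"
      by (intro tendsto_diff L LIMSEQ_Suc)
    then have "(\<lambda>n. ?a n - ?a (Suc n)) \<longlonglongrightarrow> 0" by simp
    then have "(\<lambda>n. (norm ((T ^^ n) (H z)))\<^sup>2) \<longlonglongrightarrow> 0"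
    proof (rule tendsto_sandwich[OF _ _ tendsto_const, rotated 2])
      show "\<forall>\<^sub>F n in sequentially. (norm ((T ^^ n) (H z)))\<^sup>2 \<le> ?a n - ?a (Suc n)"
      proof (rule always_eventually, rule allI)
        fix n
        show "(norm ((T ^^ n) (H z)))\<^sup>2 \<le> ?a n - ?a (Suc n)"
          using power2_norm_T[of "(T ^^ n) z"] by (simp add: H_funpow_T)
      qed
    qed simp
    then show ?thesis by (simp add: tendsto_norm_zero_iff)
  qed
  let ?v = "x - nproj B x"
  have v: "?v \<in> closure (range H)"
    using diff_nproj_in[OF H_closed, of x] nproj_eq_orth_proj[OF H_closed] nproj_eq_orth_proj[OF B]
    by (simp add: cadjoint_H null_H)
  show ?thesis
  proof (rule LIMSEQ_I)
    fix e :: real assume e: "0 < e"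
    obtain z where z: "dist (H z) ?v < e / 2"
      using v e closure_approachable[of ?v "range H"] by (metis half_gt_zero rangeE)
    obtain n0 where n0: "\<And>n. n \<ge> n0 \<Longrightarrow> norm ((T ^^ n) (H z)) < e / 2"
      using LIMSEQ_D[OF rng[of z], of "e / 2"] e by auto
    have "norm ((T ^^ n) ?v - 0) < e" if "n \<ge> n0" for n
    proof -
      have "(T ^^ n) ?v = (T ^^ n) (?v - H z) + (T ^^ n) (H z)"
        using op_linear(1)[OF funpow_closed[OF T_closed], of n "?v - H z" "H z"] by simp
      then have "norm ((T ^^ n) ?v) \<le> norm ((T ^^ n) (?v - H z)) + norm ((T ^^ n) (H z))"
        by (metis norm_triangle_ineq)
      moreover have "norm ((T ^^ n) (?v - H z)) < e / 2"
        using norm_funpow_T_mono[of 0 n "?v - H z"] z by (simp add: dist_norm norm_minus_commute)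
      ultimately show ?thesis using n0[OF that] by simp
    qed
    then show "\<exists>n0. \<forall>n\<ge>n0. norm ((T ^^ n) ?v - 0) < e" by blast
  qed
qed

text \<open>Pythagoras: T fixes null(B) pointwise and, being self-adjoint, preserves its orthogonal
  complement.\<close>

lemma power2_norm_funpow_T:
  "(norm ((T ^^ n) x))\<^sup>2 = (norm (nproj B x))\<^sup>2 + (norm ((T ^^ n) (x - nproj B x)))\<^sup>2"
proof -
  have TP: "(T ^^ n) (nproj B x) = nproj B x"
    using B by (induction n) (simp_all add: T H)
  have "(T ^^ n) x = nproj B x + (T ^^ n) (x - nproj B x)"
    using op_linear(2)[OF funpow_closed[OF T_closed], of n x "nproj B x"] by (simp add: TP)
  moreover have "cinner (nproj B x) ((T ^^ n) (x - nproj B x)) = 0"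
    unfolding funpow_T_selfadjoint[symmetric] TP using B by (intro nproj_orth) auto
  ultimately show ?thesis
    using power2_norm_add[of "nproj B x" "(T ^^ n) (x - nproj B x)"] by simp
qed

text \<open>Complements of powers, because normality speaks of increasing families. Even powers,
  because the quadratic form of T^(2n) at x is |T^n x|^2, which makes monotonicity
  immediate.\<close>

definition approx :: "nat \<Rightarrow> 'a \<Rightarrow> 'a" where
  "approx n = (\<lambda>x. x - (T ^^ (2 * n)) x)"

lemma approx_quadratic: "Re (cinner x (approx n x)) = (norm x)\<^sup>2 - (norm ((T ^^ n) x))\<^sup>2"
  by (simp add: approx_def cinner.diff_right cinner_funpow_T cinner_self)

lemma approx_selfadjoint_part: "approx n \<in> selfadjoint_part M"
proof -
  have "approx n \<in> M"
    unfolding approx_def using diff_closed[OF id_closed funpow_closed[OF T_closed]] by simp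
  moreover have "cadjoint (approx n) = approx n"
    by (rule cadjoint_eqI)
      (simp add: approx_def cinner.diff_left cinner.diff_right funpow_T_selfadjoint)
  ultimately show ?thesis by (simp add: selfadjoint_part_def)
qed

lemma approx_mono: "m \<le> n \<Longrightarrow> op_le (approx m) (approx n)"
  unfolding op_le_def approx_quadratic by (simp add: power_mono norm_funpow_T_mono)

text \<open>|T^n x|^2 decreases to |nproj B x|^2, so the quadratic forms converge upwards to that of
  1 - \<open>nproj B\<close>, and every upper bound dominates the limit.\<close>

lemma approx_lub: "op_is_lub M (range approx) (\<lambda>x. x - nproj B x)"
proof -
  have quad: "Re (cinner x (x - nproj B x)) = (norm x)\<^sup>2 - (norm (nproj B x))\<^sup>2" for x
  proof -
    have "cinner (nproj B x) (x - nproj B x) = 0" using B by (intro nproj_orth) auto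
    then have "cinner (nproj B x) x = cinner (nproj B x) (nproj B x)" by (simp add: cinner.diff_right)
    then have "cinner x (nproj B x) = cinner (nproj B x) (nproj B x)" by (metis cinner_commute)
    then show ?thesis by (simp add: cinner.diff_right cinner_self)
  qed
  have "(\<lambda>x. x - nproj B x) \<in> M"
    using diff_closed[OF id_closed nproj_closed[OF B]] by simp
  moreover have "cadjoint (\<lambda>x. x - nproj B x) = (\<lambda>x. x - nproj B x)"
    by (rule cadjoint_eqI)
      (simp add: cinner.diff_left cinner.diff_right cadjoint_eq[OF nproj_closed[OF B]] cadjoint_nproj[OF B])
  moreover have "op_le (approx n) (\<lambda>x. x - nproj B x)" for n
    unfolding op_le_def approx_quadratic quad
    by (rule allI) (subst power2_norm_funpow_T, simp)
  moreover have "op_le (\<lambda>x. x - nproj B x) R" if "\<And>n. op_le (approx n) R" for R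
    unfolding op_le_def quad
  proof
    fix x
    have "(norm x)\<^sup>2 - ((norm (nproj B x))\<^sup>2 + (norm ((T ^^ n) (x - nproj B x)))\<^sup>2) \<le> Re (cinner x (R x))" for n
      using that[of n] unfolding op_le_def approx_quadratic power2_norm_funpow_T[of n x, symmetric]
      by blast
    moreover have "(\<lambda>n. (norm x)\<^sup>2 - ((norm (nproj B x))\<^sup>2 + (norm ((T ^^ n) (x - nproj B x)))\<^sup>2))
        \<longlonglongrightarrow> (norm x)\<^sup>2 - ((norm (nproj B x))\<^sup>2 + (norm (0::'a))\<^sup>2)"
      by (intro tendsto_intros funpow_T_tendsto_0)
    ultimately have "(norm x)\<^sup>2 - ((norm (nproj B x))\<^sup>2 + (norm (0::'a))\<^sup>2) \<le> Re (cinner x (R x))"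
      by (intro LIMSEQ_le_const2) auto
    then show "(norm x)\<^sup>2 - (norm (nproj B x))\<^sup>2 \<le> Re (cinner x (R x))" by simp
  qed
  ultimately show ?thesis by (auto simp: op_is_lub_def selfadjoint_part_def)
qed

end

section \<open>Transport of null projections and null-space inclusions\<close>

locale normal_hom = M: vn_algebra M + N: vn_algebra N
  for M :: "('h::chilbert_space \<Rightarrow> 'h) set" and N :: "('k::chilbert_space \<Rightarrow> 'k) set" +
  fixes \<Phi> :: "('h \<Rightarrow> 'h) \<Rightarrow> ('k \<Rightarrow> 'k)"
  assumes hom: "unital_star_hom M N \<Phi>" and normal: "normal_map M N \<Phi>"
begin

lemma hom_closed [simp]: "A \<in> M \<Longrightarrow> \<Phi> A \<in> N"
  using hom by (auto simp: unital_star_hom_def)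

lemma hom_comp: "A \<in> M \<Longrightarrow> B \<in> M \<Longrightarrow> \<Phi> (A \<circ> B) = \<Phi> A \<circ> \<Phi> B"
  using hom by (auto simp: unital_star_hom_def)

lemma hom_add: "A \<in> M \<Longrightarrow> B \<in> M \<Longrightarrow> \<Phi> (\<lambda>x. A x + B x) = (\<lambda>x. \<Phi> A x + \<Phi> B x)"
  using hom by (auto simp: unital_star_hom_def)

lemma hom_scaleC: "A \<in> M \<Longrightarrow> \<Phi> (\<lambda>x. c *\<^sub>C A x) = (\<lambda>x. c *\<^sub>C \<Phi> A x)"
  using hom by (auto simp: unital_star_hom_def)

lemma hom_cadjoint: "A \<in> M \<Longrightarrow> \<Phi> (cadjoint A) = cadjoint (\<Phi> A)"
  using hom by (auto simp: unital_star_hom_def)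

lemma hom_id: "\<Phi> id = id"
  using hom by (auto simp: unital_star_hom_def)

lemma hom_scaleR: "A \<in> M \<Longrightarrow> \<Phi> (\<lambda>x. r *\<^sub>R A x) = (\<lambda>x. r *\<^sub>R \<Phi> A x)"
  using hom_scaleC[of A "of_real r"] by (simp add: scaleC_of_real)

lemma hom_diff:
  assumes "A \<in> M" "B \<in> M" shows "\<Phi> (\<lambda>x. A x - B x) = (\<lambda>x. \<Phi> A x - \<Phi> B x)"
  using hom_add[OF assms(1) M.scaleC_closed[OF assms(2)], of "-1"] hom_scaleC[OF assms(2), of "-1"]
  by (simp add: scaleC_minus_one)

lemma hom_one_minus: "A \<in> M \<Longrightarrow> \<Phi> (\<lambda>x. x - A x) = (\<lambda>x. x - \<Phi> A x)"
  using hom_diff[OF M.id_closed, of A] by (simp add: hom_id)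

lemma hom_funpow: "A \<in> M \<Longrightarrow> \<Phi> (A ^^ n) = \<Phi> A ^^ n"
  by (induction n) (simp_all add: hom_comp hom_id[unfolded id_def] id_def)

lemma hom_nproj:
  assumes B: "B \<in> M"
  shows "\<Phi> (nproj B) = nproj (\<Phi> B)"
proof -
  obtain K where K: "K > 0" "\<And>x. norm (cadjoint B x) \<le> K * norm x"
    using bounded_ops_bound[OF M.bounded[OF M.cadjoint_closed[OF B]]] by blast
  obtain L where L: "L > 0" "\<And>x. norm (cadjoint (\<Phi> B) x) \<le> L * norm x"
    using bounded_ops_bound[OF N.bounded[OF N.cadjoint_closed[OF hom_closed[OF B]]]] by blast
  \<comment> \<open>One scale small enough for both B and \<Phi> B, so that \<Phi> carries each
    approximant of the first to the corresponding one of the second.\<close>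
  define s where "s = 1 / (2 * max K L)"
  have s: "s > 0" using K(1) by (simp add: s_def)
  have small: "norm (s *\<^sub>R y) \<le> c / 2" if "norm y \<le> C * c" "C \<le> max K L" "0 \<le> c"
    for y :: "'b::real_normed_vector" and c C
  proof -
    have "norm y \<le> max K L * c"
      using that(1) mult_right_mono[OF that(2,3)] by linarith
    moreover have "max K L > 0" using K(1) by simp
    ultimately show ?thesis by (simp add: field_simps s_def)
  qed
  define H where "H = (\<lambda>x. (2 * s\<^sup>2) *\<^sub>R cadjoint B (B x))"
  define T where "T = (\<lambda>x. x - H x)"
  define H' where "H' = (\<lambda>x. (2 * s\<^sup>2) *\<^sub>R cadjoint (\<Phi> B) (\<Phi> B x))"
  define T' where "T' = (\<lambda>x. x - H' x)"
  interpret m: null_power M B s T H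
    by unfold_locales (use B s small[OF K(2)] in \<open>auto simp: T_def H_def fun_eq_iff\<close>)
  interpret n: null_power N "\<Phi> B" s T' H'
    by unfold_locales (use B s small[OF L(2)] in \<open>auto simp: T'_def H'_def fun_eq_iff\<close>)
  have "\<Phi> H = H'"
    using hom_scaleR[OF M.comp_closed[OF M.cadjoint_closed[OF B] B]] hom_comp[OF M.cadjoint_closed[OF B] B]
    by (simp add: H_def H'_def hom_cadjoint[OF B])
  then have "\<Phi> T = T'"
    unfolding T_def T'_def hom_one_minus[OF m.H_closed] by simp
  then have "\<Phi> (m.approx n) = n.approx n" for n
    unfolding m.approx_def n.approx_def
    by (simp add: hom_one_minus[OF M.funpow_closed[OF m.T_closed]] hom_funpow[OF m.T_closed])
  then have img: "\<Phi> ` range m.approx = range n.approx"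
    by (simp add: image_image)
  have "op_is_lub N (\<Phi> ` range m.approx) (\<Phi> (\<lambda>x. x - nproj B x))"
  proof (rule normal[unfolded normal_map_def, rule_format])
    show "range m.approx \<subseteq> selfadjoint_part M" using m.approx_selfadjoint_part by blast
    show "\<exists>C\<in>range m.approx. op_le A C \<and> op_le A' C"
      if AA': "A \<in> range m.approx" "A' \<in> range m.approx" for A A'
    proof -
      obtain i j where "A = m.approx i" "A' = m.approx j" using AA' by blast
      then show ?thesis using m.approx_mono[of i "max i j"] m.approx_mono[of j "max i j"] by auto
    qed
  qed (use m.approx_lub in auto)
  then have "\<Phi> (\<lambda>x. x - nproj B x) = (\<lambda>x. x - nproj (\<Phi> B) x)"
    unfolding img using n.approx_lub by (rule N.op_is_lub_unique)
  then have "x - \<Phi> (nproj B) x = x - nproj (\<Phi> B) x" for x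
    unfolding hom_one_minus[OF M.nproj_closed[OF B]] by (rule fun_cong)
  then show ?thesis by (simp add: fun_eq_iff)
qed

text \<open>The inclusion is encoded by A N(B) = 0, used in the form A = A - A N(B); \<Phi> turns it
  into the same identity for the images by \<open>hom_nproj\<close>.\<close>

lemma hom_null_mono:
  assumes A: "A \<in> M" and B: "B \<in> M" and null: "op_null B \<subseteq> op_null A"
  shows "op_null (\<Phi> B) \<subseteq> op_null (\<Phi> A)"
proof
  have "A (nproj B x) = 0" for x
    using null M.nproj_null[OF B, of x] by (auto simp: op_null_def)
  then have "A = (\<lambda>x. A x - (A \<circ> nproj B) x)" by simp
  then have "\<Phi> A = (\<lambda>x. \<Phi> A x - \<Phi> (A \<circ> nproj B) x)"
    using hom_diff[OF A M.comp_closed[OF A M.nproj_closed[OF B]]] by simp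
  then have *: "\<Phi> A (nproj (\<Phi> B) x) = 0" for x
    using A B by (simp add: fun_eq_iff hom_comp hom_nproj)
  fix u assume "u \<in> op_null (\<Phi> B)"
  then have "\<Phi> B u = 0" by (simp add: op_null_def)
  then have "nproj (\<Phi> B) u = u" using B by (intro N.nproj_fixes) auto
  then show "u \<in> op_null (\<Phi> A)" using *[of u] by (simp add: op_null_def)
qed

end

section \<open>Quotients\<close>

context vn_algebra
begin

lemma op_quot_apply:
  assumes A: "A \<in> M" and B: "B \<in> M" and null: "op_null B \<subseteq> op_null A"
  shows "op_quot A B (B x) = Some (A x)"
proof -
  have eq: "A x' = A x" if "B x' = B x" for x'
  proof -
    have "x' - x \<in> op_null B" using B that by (simp add: op_null_def)
    then have "A (x' - x) = 0" using null by (auto simp: op_null_def)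
    then show ?thesis using A by simp
  qed
  have "(THE z. \<exists>x'. B x' = B x \<and> z = A x') = A x"
    by (rule the_equality) (use eq in blast)+
  then show ?thesis by (simp add: op_quot_def)
qed

lemma op_quot_None: "y \<notin> range B \<Longrightarrow> op_quot A B y = None"
  by (simp add: op_quot_def)

lemma op_quot_eqI:
  assumes "A \<in> M" "B \<in> M" "op_null B \<subseteq> op_null A"
    and "\<And>x. T (B x) = Some (A x)" "\<And>y. y \<notin> range B \<Longrightarrow> T y = None"
  shows "T = op_quot A B"
proof (rule ext)
  fix y
  show "T y = op_quot A B y"
    by (cases "y \<in> range B")
      (use assms(4,5) op_quot_apply[OF assms(1-3)] op_quot_None[of y B A] in auto)
qed

lemma op_null_id_subset: "A \<in> M \<Longrightarrow> op_null id \<subseteq> op_null A"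
  by (simp add: op_null_def)

text \<open>Equal quotients have equal domains ran B = ran B', so Douglas gives B = B' C; evaluating
  both quotients at B x forces A = A' C. An equality of partial maps becomes identities in the
  algebra.\<close>

lemma op_quot_eq_imp_factor:
  assumes AB: "A \<in> M" "B \<in> M" "op_null B \<subseteq> op_null A"
    and AB': "A' \<in> M" "B' \<in> M" "op_null B' \<subseteq> op_null A'"
    and eq: "op_quot A B = op_quot A' B'"
  obtains C where "C \<in> M" "A = A' \<circ> C" "B = B' \<circ> C"
proof -
  have "range B \<subseteq> range B'"
    using op_quot_apply[OF AB] op_quot_None[of _ B' A'] eq by force
  then obtain C where C: "C \<in> M" "B = B' \<circ> C"
    using range_subset_imp_factor[OF AB(2) AB'(2)] by blast
  have "A x = A' (C x)" for x
    using op_quot_apply[OF AB, of x] op_quot_apply[OF AB', of "C x"] eq C(2) by simp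
  then show thesis using that[OF C(1) _ C(2)] by (simp add: fun_eq_iff)
qed

text \<open>The domain of the product consists of the D x for which C x = B y has a solution y, so
  \<open>pb\<close> constrains x. The partner y, supplied by E, is ambiguous up to null(B), which A
  annihilates.\<close>

lemma op_quot_comp:
  assumes AB: "A \<in> M" "B \<in> M" "op_null B \<subseteq> op_null A"
    and CD: "C \<in> M" "D \<in> M" "op_null D \<subseteq> op_null C"
    and FE: "F \<in> M" "E \<in> M" "C \<circ> F = B \<circ> E"
    and pb: "\<forall>x y. C x = B y \<longrightarrow> x \<in> range F"
  shows "op_null (D \<circ> F) \<subseteq> op_null (A \<circ> E)"
    and "op_quot A B \<circ>\<^sub>m op_quot C D = op_quot (A \<circ> E) (D \<circ> F)"
proof -
  have CF: "C (F x) = B (E x)" for x using FE(3) by (simp add: fun_eq_iff)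
  show null: "op_null (D \<circ> F) \<subseteq> op_null (A \<circ> E)"
  proof
    fix x assume "x \<in> op_null (D \<circ> F)"
    then have "C (F x) = 0" using CD(3) by (auto simp: op_null_def)
    then have "B (E x) = 0" by (simp add: CF)
    then show "x \<in> op_null (A \<circ> E)" using AB(3) by (auto simp: op_null_def)
  qed
  show "op_quot A B \<circ>\<^sub>m op_quot C D = op_quot (A \<circ> E) (D \<circ> F)"
  proof (rule op_quot_eqI[OF _ _ null])
    show "(op_quot A B \<circ>\<^sub>m op_quot C D) ((D \<circ> F) x) = Some ((A \<circ> E) x)" for x
      by (simp add: map_comp_def op_quot_apply[OF CD] CF op_quot_apply[OF AB])
    show "(op_quot A B \<circ>\<^sub>m op_quot C D) y = None" if y: "y \<notin> range (D \<circ> F)" for y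
    proof (cases "y \<in> range D")
      case True
      then obtain w where w: "y = D w" by blast
      have "C w \<notin> range B"
      proof
        assume "C w \<in> range B"
        then have "w \<in> range F" using pb by blast
        then show False using y w by auto
      qed
      then show ?thesis by (simp add: w map_comp_def op_quot_apply[OF CD] op_quot_None)
    qed (simp add: map_comp_def op_quot_None)
  qed (use AB CD FE in auto)
qed

text \<open>w = c x - b y is killed by S, hence by c^* and b^*, hence orthogonal to itself. From c x
  = b y follows x = (1 - c^* c) x + c^* b y, a vector of ran F. It is phrased through identities and
  null-space inclusions so that it applies to the images under \<Phi> as well.\<close>

lemma in_range_if_row_polar:
  assumes mem: "S \<in> M" "c \<in> M" "b \<in> M" "F \<in> M"
    and null: "op_null S \<subseteq> op_null (cadjoint c)" "op_null S \<subseteq> op_null (cadjoint b)"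
    and F: "(\<lambda>x. x - (cadjoint c \<circ> c) x) = F \<circ> u" "cadjoint c \<circ> b = F \<circ> v"
    and eq: "S (c x) = S (b y)"
  shows "x \<in> range F"
proof -
  define w where "w = c x - b y"
  have "S w = 0" using mem eq by (simp add: w_def)
  then have "cadjoint c w = 0" "cadjoint b w = 0" using null by (auto simp: op_null_def)
  then have "cinner w w = 0"
    using mem by (subst (2) w_def) (simp add: cinner.diff_right cadjoint_eq'[symmetric])
  then have "c x = b y" by (simp add: w_def)
  then have "x = F (u x) + F (v y)"
    using fun_cong[OF F(1), of x] fun_cong[OF F(2), of y] by (simp add: diff_eq_eq)
  also have "\<dots> = F (u x + v y)" using mem by simp
  finally show ?thesis by blast
qed

lemma op_null_quot:
  assumes "A \<in> M" "B \<in> M" "op_null B \<subseteq> op_null A"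
  shows "{x. op_quot A B x = Some 0} = range (B \<circ> nproj A)"
proof safe
  fix y assume y: "op_quot A B y = Some 0"
  then obtain x where x: "y = B x" using op_quot_None[of y B A] by force
  then have "A x = 0" using y op_quot_apply[OF assms, of x] by simp
  then show "y \<in> range (B \<circ> nproj A)"
    using nproj_fixes[OF assms(1), of x] x by (metis comp_apply rangeI)
qed (simp add: op_quot_apply[OF assms] assms(1))

lemma range_proj_fixes:
  assumes "X \<in> M" "y \<in> range X" shows "range_proj X y = y"
proof -
  have y: "y \<in> closure (range X)" using assms(2) closure_subset[of "range X"] by auto
  have "cinner (y - range_proj X y) (y - range_proj X y) = 0"
    using range_proj_orth[OF assms(1) y, of y] range_proj_orth[OF assms(1) range_proj_in[OF assms(1)], of y y]
    by (simp add: cinner.diff_left)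
  then show ?thesis by simp
qed

lemma range_proj_eq_nproj: "X \<in> M \<Longrightarrow> range_proj X = (\<lambda>x. x - nproj (cadjoint X) x)"
  by (simp add: nproj_def)

text \<open>The null space of A/B is B(null A), the range of B N(A), so the projection onto its
  closure lies in the algebra. If A x = 0 then B x is in that range and R x = 0, which makes R/A a
  legitimate quotient and the value at A x independent of x.\<close>

lemma kaufman_inv_op_quot:
  assumes AB: "A \<in> M" "B \<in> M" "op_null B \<subseteq> op_null A"
  defines "R \<equiv> (\<lambda>x. B x - (range_proj (B \<circ> nproj A) \<circ> B) x)"
  shows "R \<in> M" "op_null A \<subseteq> op_null R" "kaufman_inv (op_quot A B) = op_quot R A"
proof -
  let ?X = "B \<circ> nproj A"
  have X: "?X \<in> M" using AB by simp
  have P: "null_proj (op_quot A B) = range_proj ?X"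
    unfolding null_proj_def op_null_quot[OF AB] range_proj_def ..
  show R: "R \<in> M"
    unfolding R_def using diff_closed[OF AB(2) comp_closed[OF range_proj_closed[OF X] AB(2)]] .
  have "R x = 0" if "A x = 0" for x
  proof -
    have "B x = ?X x" using nproj_fixes[OF AB(1) that] by simp
    then have "range_proj ?X (B x) = B x" by (intro range_proj_fixes[OF X]) (metis rangeI)
    then show ?thesis by (simp add: R_def)
  qed
  then show null: "op_null A \<subseteq> op_null R" by (auto simp: op_null_def)
  show "kaufman_inv (op_quot A B) = op_quot R A"
  proof (rule op_quot_eqI[OF R AB(1) null])
    fix x
    have "A x \<in> ran (op_quot A B)" using op_quot_apply[OF AB] by (auto simp: ran_def)
    moreover have "(THE z. \<exists>w. op_quot A B w = Some (A x) \<and> z = w - null_proj (op_quot A B) w) = R x"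
    proof (rule the_equality)
      show "\<exists>w. op_quot A B w = Some (A x) \<and> R x = w - null_proj (op_quot A B) w"
        by (rule exI[of _ "B x"]) (simp add: op_quot_apply[OF AB] P R_def)
    next
      fix z assume "\<exists>w. op_quot A B w = Some (A x) \<and> z = w - null_proj (op_quot A B) w"
      then obtain w where w: "op_quot A B w = Some (A x)" "z = w - range_proj ?X w" by (auto simp: P)
      then obtain x' where x': "w = B x'" using op_quot_None[of w B A] by force
      then have z: "z = R x'" using w by (simp add: R_def)
      have "A (x' - x) = 0" using w(1) op_quot_apply[OF AB, of x'] AB(1) by (simp add: x')
      then have "R (x' - x) = 0" using null by (auto simp: op_null_def)
      then show "z = R x" using R z by simp
    qed
    ultimately show "kaufman_inv (op_quot A B) (A x) = Some (R x)"
      by (simp add: kaufman_inv_def)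
  next
    fix y assume y: "y \<notin> range A"
    have "y \<notin> ran (op_quot A B)"
    proof
      assume "y \<in> ran (op_quot A B)"
      then obtain w where w: "op_quot A B w = Some y" by (auto simp: ran_def)
      then obtain x where "w = B x" using op_quot_None[of w B A] by force
      then show False using y w op_quot_apply[OF AB, of x] by auto
    qed
    then show "kaufman_inv (op_quot A B) y = None" by (simp add: kaufman_inv_def)
  qed
qed

text \<open>The Kaufman inverse of B sends B x to the part of x orthogonal to null(B); the discarded
  part lies in null(B), hence is killed by A.\<close>

lemma op_quot_eq_comp_kaufman_inv:
  assumes AB: "A \<in> M" "B \<in> M" "op_null B \<subseteq> op_null A"
  shows "op_quot A B = op_quot A id \<circ>\<^sub>m kaufman_inv (op_quot B id)"
proof -
  note B = AB(2) id_closed op_null_id_subset[OF AB(2)]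
  define R where "R = (\<lambda>x. id x - (range_proj (id \<circ> nproj B) \<circ> id) x)"
  note K = kaufman_inv_op_quot[OF B, folded R_def]
  have "closure (range (id \<circ> nproj B)) \<subseteq> {x. B x = 0}"
    using AB(2) by (intro closure_minimal closed_Collect_eq continuous_intros
        linear_continuous_on bounded_opsD(1)[OF bounded]) auto
  then have "B (range_proj (id \<circ> nproj B) x) = 0" for x
    using range_proj_in[of "id \<circ> nproj B" x] AB(2) by auto
  then have "A (range_proj (id \<circ> nproj B) x) = 0" for x
    using AB(3) by (auto simp: op_null_def)
  then have AR: "A (R x) = A x" for x
    using AB(1) by (simp add: R_def)
  have Aid: "op_quot A id x = Some (A x)" for x
    using op_quot_apply[OF AB(1) id_closed op_null_id_subset[OF AB(1)], of x] by simp
  show ?thesis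
    unfolding K(3)
  proof (rule op_quot_eqI[OF AB, symmetric])
    show "(op_quot A id \<circ>\<^sub>m op_quot R B) (B x) = Some (A x)" for x
      by (simp add: map_comp_def op_quot_apply[OF K(1) AB(2) K(2)] Aid AR)
  qed (simp add: map_comp_def op_quot_None)
qed

end

section \<open>The extension to quotients: pullbacks, well-definedness, operations,
  uniqueness\<close>

context normal_hom
begin

lemma hom_range_proj: "X \<in> M \<Longrightarrow> \<Phi> (range_proj X) = range_proj (\<Phi> X)"
  by (simp add: M.range_proj_eq_nproj N.range_proj_eq_nproj hom_one_minus hom_nproj hom_cadjoint)

text \<open>\<open>(F, E)\<close> parametrises the pullback \<open>{(x, y). C x = B y}\<close>. After normalising the row
  \<open>(C, B)\<close> to the partial isometry \<open>(c, b)\<close>, this is the range of the projection onto the null space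
  of the row \<open>(c, -b)\<close>, whose matrix has first row \<open>(1 - c\<^sup>*c, c\<^sup>*b)\<close> and second
  row \<open>(b\<^sup>*c, 1 - b\<^sup>*b)\<close>.\<close>

lemma exists_pullback:
  assumes C: "C \<in> M" and B: "B \<in> M"
  obtains F E where "F \<in> M" "E \<in> M" "C \<circ> F = B \<circ> E"
    "\<forall>x y. C x = B y \<longrightarrow> x \<in> range F" "\<forall>x y. \<Phi> C x = \<Phi> B y \<longrightarrow> x \<in> range (\<Phi> F)"
proof (rule M.exists_row_polar[OF C B])
  fix S c b
  assume mem: "S \<in> M" "c \<in> M" "b \<in> M" and CB: "C = S \<circ> c" "B = S \<circ> b"
    and null: "op_null S \<subseteq> op_null (cadjoint c)" "op_null S \<subseteq> op_null (cadjoint b)"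
    and fixed: "(\<lambda>x. c (cadjoint c (c x)) + b (cadjoint b (c x))) = c"
      "(\<lambda>x. c (cadjoint c (b x)) + b (cadjoint b (b x))) = b"
  let ?p = "\<lambda>x. x - (cadjoint c \<circ> c) x" and ?q = "cadjoint c \<circ> b"
  have cc: "cadjoint c \<circ> c \<in> M" using mem by simp
  have p: "?p \<in> M" using M.diff_closed[OF M.id_closed cc] by simp
  have q: "?q \<in> M" using mem by simp
  show thesis
  \<comment> \<open>Second polar decomposition: p = F u, q = F v and F = p u^* + q v^*, so the row
    (p, q) has exactly the range of the single operator F.\<close>
  proof (rule M.exists_row_polar[OF p q])
    fix F u v
    assume mem': "F \<in> M" "u \<in> M" "v \<in> M" and pq: "?p = F \<circ> u" "?q = F \<circ> v"
      and F: "F = (\<lambda>x. ?p (cadjoint u x) + ?q (cadjoint v x))"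
    define E where "E = (\<lambda>x. (cadjoint b \<circ> c \<circ> cadjoint u) x +
      (cadjoint v x - (cadjoint b \<circ> b \<circ> cadjoint v) x))"
    show thesis
    proof (rule that[OF mem'(1)])
      show "E \<in> M"
        unfolding E_def using mem mem'
        by (intro M.add_closed M.diff_closed M.comp_closed M.cadjoint_closed)
      show "C \<circ> F = B \<circ> E"
      proof
        fix x
        have "c (F x) = b (E x)"
          using mem mem' fun_cong[OF fixed(1), of "cadjoint u x"] fun_cong[OF fixed(2), of "cadjoint v x"]
          by (subst F) (simp add: E_def algebra_simps)
        then show "(C \<circ> F) x = (B \<circ> E) x" by (simp add: CB)
      qed
      show "\<forall>x y. C x = B y \<longrightarrow> x \<in> range F"
        using M.in_range_if_row_polar[OF mem mem'(1) null pq] CB by simp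
      show "\<forall>x y. \<Phi> C x = \<Phi> B y \<longrightarrow> x \<in> range (\<Phi> F)"
      \<comment> \<open>The same argument in N: the factorizations are transported as identities,
        the two null-space inclusions by \<open>hom_null_mono\<close>.\<close>
      proof (intro allI impI, rule N.in_range_if_row_polar)
        show "op_null (\<Phi> S) \<subseteq> op_null (cadjoint (\<Phi> c))" "op_null (\<Phi> S) \<subseteq> op_null (cadjoint (\<Phi> b))"
          using hom_null_mono[OF _ mem(1) null(1)] hom_null_mono[OF _ mem(1) null(2)] mem
          by (simp_all add: hom_cadjoint)
        have "\<Phi> ?p = \<Phi> F \<circ> \<Phi> u" "\<Phi> ?q = \<Phi> F \<circ> \<Phi> v"
          unfolding pq using mem' by (simp_all add: hom_comp)
        then show "(\<lambda>x. x - (cadjoint (\<Phi> c) \<circ> \<Phi> c) x) = \<Phi> F \<circ> \<Phi> u"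
          "cadjoint (\<Phi> c) \<circ> \<Phi> b = \<Phi> F \<circ> \<Phi> v"
          unfolding hom_one_minus[OF cc] using mem by (simp_all add: hom_comp hom_cadjoint)
        show "\<Phi> S (\<Phi> c x) = \<Phi> S (\<Phi> b y)" if "\<Phi> C x = \<Phi> B y" for x y
          using that unfolding CB using mem by (simp add: hom_comp)
      qed (use mem mem' in auto)
    qed
  qed
qed

text \<open>Factorizations in both directions are needed: C carries the values across, C' gives ran
  \<Phi>(B') inside ran \<Phi>(B), so that the domains agree.\<close>

lemma op_quot_hom_cong:
  assumes AB: "A \<in> M" "B \<in> M" "op_null B \<subseteq> op_null A"
    and AB': "A' \<in> M" "B' \<in> M" "op_null B' \<subseteq> op_null A'"
    and eq: "op_quot A B = op_quot A' B'"
  shows "op_quot (\<Phi> A) (\<Phi> B) = op_quot (\<Phi> A') (\<Phi> B')"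
proof -
  obtain C where C: "C \<in> M" "A = A' \<circ> C" "B = B' \<circ> C"
    using M.op_quot_eq_imp_factor[OF AB AB' eq] .
  obtain C' where C': "C' \<in> M" "A' = A \<circ> C'" "B' = B \<circ> C'"
    using M.op_quot_eq_imp_factor[OF AB' AB eq[symmetric]] .
  have \<Phi>: "\<Phi> A x = \<Phi> A' (\<Phi> C x)" "\<Phi> B x = \<Phi> B' (\<Phi> C x)" "\<Phi> B' x = \<Phi> B (\<Phi> C' x)" for x
    using hom_comp[OF AB'(1) C(1)] hom_comp[OF AB'(2) C(1)] hom_comp[OF AB(2) C'(1)]
    by (metis C(2) comp_apply, metis C(3) comp_apply, metis C'(3) comp_apply)
  show ?thesis
  proof (rule N.op_quot_eqI[symmetric])
    show "op_null (\<Phi> B) \<subseteq> op_null (\<Phi> A)" by (rule hom_null_mono[OF AB])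
    show "op_quot (\<Phi> A') (\<Phi> B') (\<Phi> B x) = Some (\<Phi> A x)" for x
      unfolding \<Phi>(1,2) using AB' by (intro N.op_quot_apply hom_null_mono) auto
    show "op_quot (\<Phi> A') (\<Phi> B') y = None" if "y \<notin> range (\<Phi> B)" for y
      using that \<Phi>(3) by (intro N.op_quot_None) auto
  qed (use AB in auto)
qed

lemma aff_ext_op_quot:
  assumes AB: "A \<in> M" "B \<in> M" "op_null B \<subseteq> op_null A"
  shows "aff_ext M \<Phi> (op_quot A B) = op_quot (\<Phi> A) (\<Phi> B)"
  unfolding aff_ext_def
proof (rule the_equality)
  fix R assume "\<exists>A'\<in>M. \<exists>B'\<in>M. op_null B' \<subseteq> op_null A' \<and> op_quot A B = op_quot A' B' \<and>
    R = op_quot (\<Phi> A') (\<Phi> B')"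
  then show "R = op_quot (\<Phi> A) (\<Phi> B)" using op_quot_hom_cong[OF AB] by metis
qed (use AB in blast)

lemma aff_ext_in: "aff_ext M \<Phi> \<in> aff M \<rightarrow> aff N"
proof
  fix T assume "T \<in> aff M"
  then obtain A B where AB: "A \<in> M" "B \<in> M" "op_null B \<subseteq> op_null A" and T: "T = op_quot A B"
    unfolding aff_def by blast
  show "aff_ext M \<Phi> T \<in> aff N"
    unfolding T aff_ext_op_quot[OF AB] aff_def using AB hom_null_mono[OF AB] hom_closed by blast
qed

lemma aff_ext_extends: "extends_map M \<Phi> (aff_ext M \<Phi>)"
  unfolding extends_map_def
  using aff_ext_op_quot[OF _ M.id_closed M.op_null_id_subset] by (simp add: hom_id)

lemma aff_ext_respects_product: "respects_product M (aff_ext M \<Phi>)"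
  unfolding respects_product_def
proof (intro ballI)
  fix S T assume "S \<in> aff M" "T \<in> aff M"
  then obtain A B C D where AB: "A \<in> M" "B \<in> M" "op_null B \<subseteq> op_null A" and S: "S = op_quot A B"
    and CD: "C \<in> M" "D \<in> M" "op_null D \<subseteq> op_null C" and T: "T = op_quot C D"
    unfolding aff_def by blast
  obtain F E where F: "F \<in> M" and E: "E \<in> M" and FE: "C \<circ> F = B \<circ> E"
    and pb: "\<forall>x y. C x = B y \<longrightarrow> x \<in> range F" "\<forall>x y. \<Phi> C x = \<Phi> B y \<longrightarrow> x \<in> range (\<Phi> F)"
    using exists_pullback[OF CD(1) AB(2)] by metis
  note m = M.op_quot_comp[OF AB CD F E FE pb(1)]
  have "\<Phi> C \<circ> \<Phi> F = \<Phi> B \<circ> \<Phi> E"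
    using hom_comp[OF CD(1) F] hom_comp[OF AB(2) E] FE by simp
  \<comment> \<open>The images of the same F and E parametrise the pullback in N, so both products
    are computed by one formula.\<close>
  note n = N.op_quot_comp[OF _ _ hom_null_mono[OF AB] _ _ hom_null_mono[OF CD] _ _ this pb(2)]
  have "aff_ext M \<Phi> (S \<circ>\<^sub>m T) = op_quot (\<Phi> (A \<circ> E)) (\<Phi> (D \<circ> F))"
    unfolding S T m(2) by (rule aff_ext_op_quot[OF _ _ m(1)]) (use AB CD F E in auto)
  also have "\<dots> = op_quot (\<Phi> A \<circ> \<Phi> E) (\<Phi> D \<circ> \<Phi> F)"
    using AB CD F E by (simp add: hom_comp)
  also have "\<dots> = op_quot (\<Phi> A) (\<Phi> B) \<circ>\<^sub>m op_quot (\<Phi> C) (\<Phi> D)"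
    by (rule n(2)[symmetric]) (use AB CD F E in auto)
  finally show "aff_ext M \<Phi> (S \<circ>\<^sub>m T) = aff_ext M \<Phi> S \<circ>\<^sub>m aff_ext M \<Phi> T"
    unfolding S T aff_ext_op_quot[OF AB] aff_ext_op_quot[OF CD] .
qed

lemma aff_ext_respects_kaufman_inv: "respects_kaufman_inv M (aff_ext M \<Phi>)"
  unfolding respects_kaufman_inv_def
proof
  fix T assume "T \<in> aff M"
  then obtain A B where AB: "A \<in> M" "B \<in> M" "op_null B \<subseteq> op_null A" and T: "T = op_quot A B"
    unfolding aff_def by blast
  note m = M.kaufman_inv_op_quot[OF AB]
  note n = N.kaufman_inv_op_quot[OF hom_closed[OF AB(1)] hom_closed[OF AB(2)] hom_null_mono[OF AB]]
  have X: "B \<circ> nproj A \<in> M" using AB by simp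
  have R: "\<Phi> (\<lambda>x. B x - (range_proj (B \<circ> nproj A) \<circ> B) x) =
      (\<lambda>x. \<Phi> B x - (range_proj (\<Phi> B \<circ> nproj (\<Phi> A)) \<circ> \<Phi> B) x)"
    unfolding hom_diff[OF AB(2) M.comp_closed[OF M.range_proj_closed[OF X] AB(2)]]
    using AB X by (simp add: hom_comp[OF M.range_proj_closed[OF X] AB(2)] hom_range_proj hom_comp hom_nproj)
  show "aff_ext M \<Phi> (kaufman_inv T) = kaufman_inv (aff_ext M \<Phi> T)"
    unfolding T m(3) aff_ext_op_quot[OF AB] n(3) aff_ext_op_quot[OF m(1) AB(1) m(2)] R ..
qed

lemma aff_ext_unique:
  assumes ext: "extends_map M \<Phi> \<Psi>" and prod: "respects_product M \<Psi>"
    and kauf: "respects_kaufman_inv M \<Psi>" and T: "T \<in> aff M"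
  shows "\<Psi> T = aff_ext M \<Phi> T"
proof -
  obtain A B where AB: "A \<in> M" "B \<in> M" "op_null B \<subseteq> op_null A" and T: "T = op_quot A B"
    using T unfolding aff_def by blast
  have aff: "op_quot X id \<in> aff M" if "X \<in> M" for X
    unfolding aff_def using that M.id_closed M.op_null_id_subset by blast
  have "kaufman_inv (op_quot B id) \<in> aff M"
    unfolding aff_def
    using M.kaufman_inv_op_quot[OF AB(2) M.id_closed M.op_null_id_subset[OF AB(2)]] AB(2) by blast
  then have "\<Psi> T = \<Psi> (op_quot A id) \<circ>\<^sub>m \<Psi> (kaufman_inv (op_quot B id))"
    unfolding T M.op_quot_eq_comp_kaufman_inv[OF AB]
    using prod aff[OF AB(1)] by (simp add: respects_product_def)
  also have "\<dots> = op_quot (\<Phi> A) id \<circ>\<^sub>m kaufman_inv (op_quot (\<Phi> B) id)"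
    using kauf ext AB aff[OF AB(2)] by (simp add: respects_kaufman_inv_def extends_map_def)
  also have "\<dots> = op_quot (\<Phi> A) (\<Phi> B)"
    by (rule N.op_quot_eq_comp_kaufman_inv[symmetric]) (use AB hom_null_mono[OF AB] in auto)
  finally show ?thesis unfolding T aff_ext_op_quot[OF AB] .
qed

end

theorem theorem4p15:
  fixes M :: "('h::chilbert_space \<Rightarrow> 'h) set"
    and N :: "('k::chilbert_space \<Rightarrow> 'k) set"
    and \<Phi> :: "('h \<Rightarrow> 'h) \<Rightarrow> ('k \<Rightarrow> 'k)"
  assumes "von_neumann_algebra M"
    and "von_neumann_algebra N"
    and "unital_star_hom M N \<Phi>"
    and "normal_map M N \<Phi>"
  shows "(\<forall>A\<in>M. \<forall>B\<in>M. op_null B \<subseteq> op_null A \<longrightarrow>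
            op_null (\<Phi> B) \<subseteq> op_null (\<Phi> A) \<and>
            aff_ext M \<Phi> (op_quot A B) = op_quot (\<Phi> A) (\<Phi> B))
       \<and> aff_ext M \<Phi> \<in> aff M \<rightarrow> aff N
       \<and> extends_map M \<Phi> (aff_ext M \<Phi>)
       \<and> respects_product M (aff_ext M \<Phi>)
       \<and> respects_kaufman_inv M (aff_ext M \<Phi>)
       \<and> (\<forall>\<Psi>. \<Psi> \<in> aff M \<rightarrow> aff N \<longrightarrow> extends_map M \<Phi> \<Psi> \<longrightarrow>
              respects_product M \<Psi> \<longrightarrow> respects_kaufman_inv M \<Psi> \<longrightarrow>
              (\<forall>T\<in>aff M. \<Psi> T = aff_ext M \<Phi> T))"
proof -
  interpret normal_hom M N \<Phi>
    by unfold_locales (use assms in auto)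
  show ?thesis
    using hom_null_mono aff_ext_op_quot aff_ext_in aff_ext_extends aff_ext_respects_product
      aff_ext_respects_kaufman_inv aff_ext_unique by blast
qed

end
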